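(* There is a universal constant $C>0$ such that the following holds. Let $f\colon\mathbb{R}^d\to\mathbb{R}$ be three times continuously differentiable, $x_0\in\mathbb{R}^d$, $\sigma_{\mathrm{init}}>0$, and let $L_0>0$, $L_1\ge 0$ be constants such that $\|\nabla^3 f(x)\|\le L_0+L_1\|\nabla f(x)\|$ for all $x\in\mathbb{R}^d$. Suppose $\Delta := f(x_0)-\inf_{x\in\mathbb{R}^d} f(x)<+\infty$. Let $\varepsilon,\delta>0$ and define $$\bar\sigma_{\mathrm{init}} := \max\{\sigma_{\mathrm{init}},\,4L_1\|\nabla f(x_0)\|\},\qquad k_0 := \max\left\{1,\ \left\lceil \log_2\frac{\bar\sigma_{\mathrm{init}}}{L_0+L_1^{3/2}\Delta}\right\rceil\right\}.$$ Then the cubic-regularized Newton method with backtracking (described in the context), started from $x_0$ and $\sigma_{\mathrm{init}}$, finds an $(\varepsilon,\delta)$-stationary point after at most $$C\left(\Delta\left(\frac{\sqrt{L_0}}{\varepsilon^{3/2}}+\frac{\sqrt{L_1}}{\varepsilon}+\frac{L_0^2}{\delta^3}+\frac{L_1}{\delta}\right)+k_0+\left[\log\frac{L_0+L_1^{3/2}\Delta}{\sigma_{\mathrm{init}}}\right]_+\right)$$ oracle calls.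
   Context: Norms: Euclidean norm for vectors, operator norm for matrices, and $\|T\|:=\sup_{\|u_1\|=\|u_2\|=\|u_3\|=1}|T[u_1,u_2,u_3]|$ for symmetric third-order tensors. $[a]_+:=\max\{a,0\}$. A point $x$ is $(\varepsilon,\delta)$-stationary (an $(\varepsilon,\delta)$-second-order stationary point) if $\|\nabla f(x)\|\le\varepsilon$ and $\nabla^2 f(x)\succeq-\delta I$. An oracle call at a point $x$ returns $f(x),\nabla f(x),\nabla^2 f(x)$. The method "finds" an $(\varepsilon,\delta)$-stationary point when one of its iterates $x_k$, at which the oracle has been called, is $(\varepsilon,\delta)$-stationary. Algorithm (cubic-regularized Newton method with backtracking). Input: $x_0\in\mathbb{R}^d$, $\sigma_{\mathrm{init}}>0$. Set $\sigma\leftarrow\sigma_{\mathrm{init}}$. For $k=0,1,2,\dots$: call the oracle to compute $g_k:=\nabla f(x_k)$, $H_k:=\nabla^2 f(x_k)$; then repeat the following trial loop. Compute a trial step $s\in\mathbb{R}^d$ (any $s$, obtained by approximately minimizing $\langle g_k,s\rangle+\frac12\langle H_ks,s\rangle+\frac\sigma3\|s\|^3$, with no oracle calls) satisfying $$\text{(i)}\ \big\|g_k+H_ks+\sigma\|s\|s\big\|\le\tfrac{\sigma}{12}\|s\|^2,\qquad \text{(ii)}\ H_k+\tfrac76\sigma\|s\|I\succeq O.$$ Check, with one oracle call at $x_k+s$, the acceptance conditions $$\text{(iii)}\ f(x_k+s)-f(x_k)\le-\tfrac\sigma6\|s\|^3,\qquad\text{(iv)}\ \|\nabla f(x_k+s)\|\le\tfrac{19}{12}\sigma\|s\|^2.$$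 If both (iii) and (iv) hold, set $(\sigma_k,s_k)\leftarrow(\sigma,s)$ and leave the loop; otherwise set $\sigma\leftarrow2\sigma$ and repeat the loop. After leaving the loop, set $x_{k+1}\leftarrow x_k+s_k$ and $\sigma\leftarrow\sigma/2$ (so the first trial value in iteration $k+1$ is $\sigma_k/2$). The algorithm does not use $L_0$, $L_1$, $\Delta$; the result holds for every choice of trial steps satisfying (i) and (ii). *)

theory Defs
  imports "HOL-Analysis.Analysis"
begin

(* The dimension is an ordinary natural number rather than a type, so that a constant can be
   quantified before (hence independently of) the dimension. Vectors of R^d are the sequences
   vanishing from index d on; on euclid d the product topology of nat => real is the
   Euclidean topology. All sums below only involve coordinates i < d, so the values of
   gradients, Hessians and third derivatives at indices i >= d are irrelevant. *)

type_synonym vect = "nat \<Rightarrow> real"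

definition euclid :: "nat \<Rightarrow> vect set"
  where "euclid d = {x. \<forall>i\<ge>d. x i = 0}"

definition vnorm :: "nat \<Rightarrow> vect \<Rightarrow> real"
  where "vnorm d x = L2_set x {..<d}"

definition partial :: "nat \<Rightarrow> (vect \<Rightarrow> real) \<Rightarrow> vect \<Rightarrow> real"
  where "partial i f x = deriv (\<lambda>t. f (x(i := t))) (x i)"

text \<open>\<open>C_diff d k f\<close>: \<open>f\<close> is \<open>k\<close> times continuously differentiable on \<open>R^d\<close>, i.e. all
  iterated partial derivatives up to order \<open>k\<close> exist and are continuous.\<close>

fun C_diff :: "nat \<Rightarrow> nat \<Rightarrow> (vect \<Rightarrow> real) \<Rightarrow> bool" where
  "C_diff d 0 f \<longleftrightarrow> continuous_on (euclid d) f"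
| "C_diff d (Suc k) f \<longleftrightarrow> continuous_on (euclid d) f \<and>
     (\<forall>i<d. (\<forall>x\<in>euclid d. (\<lambda>t. f (x(i := t))) differentiable (at (x i))) \<and>
            C_diff d k (partial i f))"

definition grad :: "(vect \<Rightarrow> real) \<Rightarrow> vect \<Rightarrow> vect"
  where "grad f x = (\<lambda>i. partial i f x)"

definition hess :: "(vect \<Rightarrow> real) \<Rightarrow> vect \<Rightarrow> nat \<Rightarrow> nat \<Rightarrow> real"
  where "hess f x = (\<lambda>i j. partial i (partial j f) x)"

definition third :: "(vect \<Rightarrow> real) \<Rightarrow> vect \<Rightarrow> nat \<Rightarrow> nat \<Rightarrow> nat \<Rightarrow> real"
  where "third f x = (\<lambda>i j k. partial i (partial j (partial k f)) x)"

definition mat_vec :: "nat \<Rightarrow> (nat \<Rightarrow> nat \<Rightarrow> real) \<Rightarrow> vect \<Rightarrow> vect"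
  where "mat_vec d A v = (\<lambda>i. \<Sum>j<d. A i j * v j)"

definition tensor_app :: "nat \<Rightarrow> (nat \<Rightarrow> nat \<Rightarrow> nat \<Rightarrow> real) \<Rightarrow> vect \<Rightarrow> vect \<Rightarrow> vect \<Rightarrow> real"
  where "tensor_app d T u v w = (\<Sum>i<d. \<Sum>j<d. \<Sum>k<d. T i j k * u i * v j * w k)"

definition usphere :: "nat \<Rightarrow> vect set"
  where "usphere d = {u \<in> euclid d. vnorm d u = 1}"

definition tensor_norm :: "nat \<Rightarrow> (nat \<Rightarrow> nat \<Rightarrow> nat \<Rightarrow> real) \<Rightarrow> real"
  where "tensor_norm d T =
    (SUP (u, v, w) \<in> usphere d \<times> usphere d \<times> usphere d. \<bar>tensor_app d T u v w\<bar>)"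

definition psd :: "nat \<Rightarrow> (nat \<Rightarrow> nat \<Rightarrow> real) \<Rightarrow> bool"
  where "psd d A \<longleftrightarrow> (\<forall>v\<in>euclid d. 0 \<le> (\<Sum>i<d. v i * mat_vec d A v i))"

definition add_id :: "(nat \<Rightarrow> nat \<Rightarrow> real) \<Rightarrow> real \<Rightarrow> nat \<Rightarrow> nat \<Rightarrow> real"
  where "add_id A c = (\<lambda>i j. A i j + (if i = j then c else 0))"

definition stationary :: "nat \<Rightarrow> (vect \<Rightarrow> real) \<Rightarrow> real \<Rightarrow> real \<Rightarrow> vect \<Rightarrow> bool"
  where "stationary d f \<epsilon> \<delta> x \<longleftrightarrow>
    vnorm d (grad f x) \<le> \<epsilon> \<and> psd d (add_id (hess f x) \<delta>)"

definition vadd :: "vect \<Rightarrow> vect \<Rightarrow> vect"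
  where "vadd x s = (\<lambda>i. x i + s i)"

definition trial_step :: "nat \<Rightarrow> (vect \<Rightarrow> real) \<Rightarrow> real \<Rightarrow> vect \<Rightarrow> vect \<Rightarrow> bool"
  where "trial_step d f \<sigma> x s \<longleftrightarrow> s \<in> euclid d \<and>
    vnorm d (\<lambda>i. grad f x i + mat_vec d (hess f x) s i + \<sigma> * vnorm d s * s i)
      \<le> \<sigma> / 12 * (vnorm d s)\<^sup>2 \<and>
    psd d (add_id (hess f x) (7 / 6 * \<sigma> * vnorm d s))"

definition acceptable :: "nat \<Rightarrow> (vect \<Rightarrow> real) \<Rightarrow> real \<Rightarrow> vect \<Rightarrow> vect \<Rightarrow> bool"
  where "acceptable d f \<sigma> x s \<longleftrightarrow>
    f (vadd x s) - f x \<le> - (\<sigma> / 6 * vnorm d s ^ 3) \<and>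
    vnorm d (grad f (vadd x s)) \<le> 19 / 12 * \<sigma> * (vnorm d s)\<^sup>2"

text \<open>A state \<open>(x, \<sigma>, n)\<close> describes the algorithm just before a trial: \<open>x\<close> is the current
  iterate, \<open>\<sigma>\<close> the current trial value, and \<open>n\<close> the number of oracle calls made so far, the call
  at \<open>x\<close> that opens the current outer iteration included. One transition is one trial. Its
  oracle call at \<open>x + s\<close> counts once; if it is accepted, the next outer iteration starts with
  another (separately counted) call at the new iterate.\<close>

inductive cubic_newton_step ::
  "nat \<Rightarrow> (vect \<Rightarrow> real) \<Rightarrow> vect \<times> real \<times> nat \<Rightarrow> vect \<times> real \<times> nat \<Rightarrow> bool"
  for d f where
  accept: "trial_step d f \<sigma> x s \<Longrightarrow> acceptable d f \<sigma> x s \<Longrightarrow>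
    cubic_newton_step d f (x, \<sigma>, n) (vadd x s, \<sigma> / 2, n + 2)"
| reject: "trial_step d f \<sigma> x s \<Longrightarrow> \<not> acceptable d f \<sigma> x s \<Longrightarrow>
    cubic_newton_step d f (x, \<sigma>, n) (x, 2 * \<sigma>, n + 1)"

definition cubic_newton_run ::
  "nat \<Rightarrow> (vect \<Rightarrow> real) \<Rightarrow> vect \<Rightarrow> real \<Rightarrow> (nat \<Rightarrow> vect \<times> real \<times> nat) \<Rightarrow> bool"
  where "cubic_newton_run d f x0 \<sigma>init run \<longleftrightarrow>
    run 0 = (x0, \<sigma>init, 1) \<and> (\<forall>t. cubic_newton_step d f (run t) (run (Suc t)))"

definition finds_within ::
  "nat \<Rightarrow> (vect \<Rightarrow> real) \<Rightarrow> real \<Rightarrow> real \<Rightarrow> (nat \<Rightarrow> vect \<times> real \<times> nat) \<Rightarrow> real \<Rightarrow> bool"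
  where "finds_within d f \<epsilon> \<delta> run N \<longleftrightarrow>
    (\<exists>t x \<sigma> n. run t = (x, \<sigma>, n) \<and> stationary d f \<epsilon> \<delta> x \<and> real n \<le> N)"

end

theory Submission
  imports Defs
begin

text \<open>
  Let \<open>g\<close> and \<open>H\<close> be the gradient and the Hessian at the current point, \<open>s\<close> a trial step and \<open>\<sigma>\<close> its
  regularization parameter. By Taylor's formula the trial is accepted as soon as the third derivative on the
  segment from \<open>x\<close> to \<open>x + s\<close> is at most \<open>\<sigma>\<close>. The third derivative is controlled by the gradient norm on the
  segment, which in turn is controlled if \<open>s\<close> is short compared with \<open>1 / sqrt L1\<close>; a bound \<open>H \<succeq> - M I\<close>
  makes it short. Quantitatively, a rejected trial satisfies
  \<open>\<sigma> < 12 (L0 + L1 \<parallel>g\<parallel> + sqrt L1 M)\<close> (\<open>large_regularization_accepted\<close>).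

  Let \<open>\<sigma>\<^sub>k\<close>, \<open>r\<^sub>k\<close>, \<open>D\<^sub>k\<close> be the parameter, the length and the decrease of the \<open>k\<close>-th accepted step. The accepted step
  itself bounds the curvature by \<open>M = 7/6 \<sigma>\<^sub>k r\<^sub>k\<close>, so a parameter that was ever doubled at iterate \<open>k\<close> is of the
  order of \<open>L0\<close>, of \<open>L1 \<parallel>g\<^sub>k\<parallel>\<close> or of \<open>sqrt L1 \<sigma>\<^sub>k r\<^sub>k\<close>. The last two cases require progress: with \<open>P = L1\<^bsup>3/2\<^esup>\<close>, in the
  third case \<open>\<sigma>\<^sub>k\<close> is at most a multiple of \<open>P D\<^sub>k\<close>, and in the second of \<open>P D\<^sub>k\<^sub>-\<^sub>1\<close>
  (\<open>regularization_bound\<close>).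

  If iterate \<open>k\<close> is not stationary, then either \<open>\<sigma>\<^sub>k r\<^sub>k\<close> exceeds a multiple of \<open>\<delta>\<close>, or \<open>\<epsilon> < \<parallel>g\<^sub>k\<parallel>\<close>, which is at most a multiple
  of \<open>\<sigma>\<^sub>k\<^sub>-\<^sub>1 r\<^sub>k\<^sub>-\<^sub>1\<^sup>2\<close>. Where the parameter is below a threshold \<open>\<tau>\<close> of order \<open>L0 + min (L1 \<epsilon>) (sqrt L1 \<delta>)\<close>, this forces
  the responsible step to decrease \<open>f\<close> by the reciprocal of the asserted rate (\<open>curvature_charge\<close>, \<open>gradient_charge\<close>), and
  the total decrease is at most \<open>\<Delta>\<close>. Iterations with a parameter above the threshold are counted by the
  potential \<open>max 0 (log 2 (\<sigma>\<^sub>k / \<tau>))\<close>: it drops by one whenever a parameter above the threshold is halved, and every increase is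
  paid for by decrease of \<open>f\<close> at a price of \<open>P / \<tau>\<close> per unit, which is again at most the rate. Its initial
  value accounts for \<open>k0\<close> (\<open>count_nonstationary\<close>).

  Finally each rejection doubles \<open>\<sigma>\<close> and each acceptance halves it, so the number of rejections exceeds the
  number of acceptances by \<open>log 2\<close> of the ratio of the current to the initial parameter; as \<open>\<sigma>\<close> stays
  below a multiple of the larger one of the two scales \<open>\<sigma>bar\<close> and \<open>L0 + P \<Delta>\<close>, this adds only the logarithmic
  terms of the bound (\<open>calls_start\<close>, \<open>oracle_calls_le\<close>).
\<close>

section \<open>Calculus along lines\<close>

lemma euclid_upd [simp]: "x \<in> euclid d \<Longrightarrow> i < d \<Longrightarrow> x(i := t) \<in> euclid d"
  by (auto simp: euclid_def)

lemma euclid_line [simp]: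
  "x \<in> euclid d \<Longrightarrow> s \<in> euclid d \<Longrightarrow> (\<lambda>j. x j + t * s j) \<in> euclid d"
  by (auto simp: euclid_def)

lemma vadd_euclid [simp]: "x \<in> euclid d \<Longrightarrow> s \<in> euclid d \<Longrightarrow> vadd x s \<in> euclid d"
  by (auto simp: euclid_def vadd_def)

lemma C_diff_continuous: "C_diff d k f \<Longrightarrow> continuous_on (euclid d) f"
  by (cases k) auto

lemma C_diff_partial: "C_diff d (Suc k) f \<Longrightarrow> i < d \<Longrightarrow> C_diff d k (partial i f)"
  by simp

lemma tendsto_componentwise_fun:
  fixes z :: "'a \<Rightarrow> 'i \<Rightarrow> 'b::topological_space"
  assumes "\<And>i. ((\<lambda>h. z h i) \<longlongrightarrow> x i) F"
  shows "(z \<longlongrightarrow> x) F"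
proof -
  have "limitin (product_topology (\<lambda>_. euclidean) UNIV) z x F"
    using assms by (auto simp: limitin_componentwise)
  then show ?thesis by (simp add: euclidean_product_topology)
qed

lemma partial_has_derivative:
  assumes "C_diff d (Suc k) f" "i < d" "y \<in> euclid d"
  shows "((\<lambda>t. f (y(i := t))) has_real_derivative partial i f (y(i := t))) (at t)"
proof -
  have "\<forall>x\<in>euclid d. (\<lambda>u. f (x(i := u))) differentiable (at (x i))"
    using assms by simp
  from bspec[OF this euclid_upd[OF assms(3,2), of t]]
  have "(\<lambda>u. f (y(i := u))) differentiable (at t)"
    by (simp only: fun_upd_upd fun_upd_same)
  then show ?thesis
    by (simp add: partial_def DERIV_deriv_iff_real_differentiable)
qed

lemma mvt_coordinate:
  assumes "C_diff d (Suc k) f" "i < d" "y \<in> euclid d"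
  shows "\<exists>\<theta>\<in>{0..1}. f (y(i := a + c)) - f (y(i := a)) = c * partial i f (y(i := a + \<theta> * c))"
proof -
  let ?\<phi> = "\<lambda>\<theta>. f (y(i := a + \<theta> * c))"
  have "\<exists>\<theta>>0. \<theta> < 1 \<and> ?\<phi> 1 - ?\<phi> 0 = (1 - 0) * (partial i f (y(i := a + \<theta> * c)) * c)"
  proof (rule MVT2[where f = ?\<phi>])
    fix \<theta> :: real
    have lin: "((\<lambda>\<theta>. a + \<theta> * c) has_real_derivative c) (at \<theta>)"
      by (auto intro!: derivative_eq_intros)
    show "((\<lambda>\<theta>. f (y(i := a + \<theta> * c))) has_real_derivative
        partial i f (y(i := a + \<theta> * c)) * c) (at \<theta>)"
      using DERIV_chain[OF partial_has_derivative[OF assms] lin] by (simp add: o_def)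
  qed simp
  then obtain \<theta> where "0 < \<theta>" "\<theta> < 1"
    "f (y(i := a + c)) - f (y(i := a)) = c * partial i f (y(i := a + \<theta> * c))"
    by (auto simp: mult.commute)
  then show ?thesis by (intro bexI[of _ \<theta>]) auto
qed

text \<open>Passing from \<open>x\<close> to \<open>x + h s\<close> one coordinate at a time writes the increment of \<open>f\<close> as a
  sum of \<open>h s\<^sub>i \<partial>\<^sub>i f\<close> at points that tend to \<open>x\<close>; continuity of the partial derivatives does
  the rest.\<close>

lemma derivative_along_line_at_0:
  assumes f: "C_diff d (Suc k) f" and x: "x \<in> euclid d" and s: "s \<in> euclid d"
  shows "((\<lambda>t. f (\<lambda>j. x j + t * s j)) has_real_derivative (\<Sum>i<d. s i * partial i f x)) (at 0)"
proof -
  define y where "y i h = (\<lambda>j. if j < i then x j + h * s j else x j)" for i :: nat and h :: real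
  have y_in: "y i h \<in> euclid d" for i h
    using x s by (auto simp: y_def euclid_def)
  have ex: "\<exists>\<theta>. \<theta> \<in> {0..1} \<and> f (y (Suc i) h) - f (y i h)
      = h * s i * partial i f ((y i h)(i := x i + \<theta> * (h * s i)))" if i: "i < d" for i h
  proof -
    have eqs: "(y i h)(i := x i + h * s i) = y (Suc i) h" "(y i h)(i := x i) = y i h"
      by (auto simp: y_def)
    show ?thesis
      using mvt_coordinate[OF f i y_in[of i h], of "x i" "h * s i"]
      unfolding eqs Bex_def .
  qed
  define \<theta> where "\<theta> i h = (SOME \<theta>. \<theta> \<in> {0..1} \<and> f (y (Suc i) h) - f (y i h)
      = h * s i * partial i f ((y i h)(i := x i + \<theta> * (h * s i))))" for i h
  define z where "z i h = (y i h)(i := x i + \<theta> i h * (h * s i))" for i h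
  have \<theta>_step: "\<theta> i h \<in> {0..1} \<and> f (y (Suc i) h) - f (y i h)
      = h * s i * partial i f ((y i h)(i := x i + \<theta> i h * (h * s i)))" if "i < d" for i h
    unfolding \<theta>_def by (rule someI_ex[OF ex[OF that]])
  have \<theta>: "\<theta> i h \<in> {0..1}" if "i < d" for i h
    using \<theta>_step[OF that] by (rule conjunct1)
  have step: "f (y (Suc i) h) - f (y i h) = h * s i * partial i f (z i h)" if "i < d" for i h
    unfolding z_def using \<theta>_step[OF that] by (rule conjunct2)
  have lim: "((\<lambda>h. \<Sum>i<d. s i * partial i f (z i h)) \<longlongrightarrow> (\<Sum>i<d. s i * partial i f x)) (at 0)"
  proof (intro tendsto_sum tendsto_mult tendsto_const)
    fix i assume "i \<in> {..<d}"
    then have i: "i < d" by simp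
    have "((\<lambda>h. z i h j) \<longlongrightarrow> x j) (at 0)" for j
    proof -
      have "norm (z i h j - x j) \<le> \<bar>h\<bar> * \<bar>s j\<bar>" for h
        using \<theta>[OF i, of h] mult_right_mono[of "\<theta> i h" 1 "\<bar>h\<bar> * \<bar>s j\<bar>"]
        by (auto simp: z_def y_def abs_mult)
      moreover have "((\<lambda>h. \<bar>h\<bar> * \<bar>s j\<bar>) \<longlongrightarrow> 0) (at (0::real))"
        by (auto intro!: tendsto_eq_intros)
      ultimately have "((\<lambda>h. z i h j - x j) \<longlongrightarrow> 0) (at 0)"
        by (rule Lim_null_comparison[OF always_eventually[OF allI]])
      then show ?thesis by (simp add: LIM_zero_iff)
    qed
    then have "(z i \<longlongrightarrow> x) (at 0)"
      by (rule tendsto_componentwise_fun)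
    moreover have "continuous_on (euclid d) (partial i f)"
      using f i by (intro C_diff_continuous[of d k]) simp
    moreover have "\<forall>\<^sub>F h in at 0. z i h \<in> euclid d"
      using y_in i by (auto simp: z_def)
    ultimately show "((\<lambda>h. partial i f (z i h)) \<longlongrightarrow> partial i f x) (at 0)"
      using x by (intro continuous_on_tendsto_compose[of "euclid d" "partial i f"])
  qed
  have quotient: "(f (\<lambda>j. x j + (0 + h) * s j) - f (\<lambda>j. x j + 0 * s j)) / h
      = (\<Sum>i<d. s i * partial i f (z i h))" if "h \<noteq> 0" for h
  proof -
    have "y d h = (\<lambda>j. x j + h * s j)" "y 0 h = x"
      using s by (auto simp: y_def euclid_def)
    then have "f (\<lambda>j. x j + h * s j) - f x = (\<Sum>i<d. f (y (Suc i) h) - f (y i h))"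
      by (simp only: sum_lessThan_telescope[of "\<lambda>i. f (y i h)"])
    also have "\<dots> = h * (\<Sum>i<d. s i * partial i f (z i h))"
      by (simp add: step sum_distrib_left mult.assoc)
    finally show ?thesis using that by simp
  qed
  have "\<forall>\<^sub>F h in at 0. (\<Sum>i<d. s i * partial i f (z i h))
      = (f (\<lambda>j. x j + (0 + h) * s j) - f (\<lambda>j. x j + 0 * s j)) / h"
    unfolding eventually_at_filter by (intro always_eventually allI impI quotient[symmetric])
  with lim show ?thesis
    unfolding DERIV_def by (rule Lim_transform_eventually)
qed

lemma derivative_along_line:
  assumes f: "C_diff d (Suc k) f" and x: "x \<in> euclid d" and s: "s \<in> euclid d"
  shows "((\<lambda>t. f (\<lambda>j. x j + t * s j)) has_real_derivative
    (\<Sum>i<d. s i * partial i f (\<lambda>j. x j + t * s j))) (at t)"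
proof -
  have "((\<lambda>u. f (\<lambda>j. x j + (u + t) * s j)) has_real_derivative
      (\<Sum>i<d. s i * partial i f (\<lambda>j. x j + t * s j))) (at 0)"
    using derivative_along_line_at_0[OF f euclid_line[OF x s] s, of t]
    by (simp add: algebra_simps)
  then show ?thesis
    using DERIV_shift[of "\<lambda>t. f (\<lambda>j. x j + t * s j)" _ 0 t] by simp
qed

text \<open>The second difference of \<open>f\<close> over the square with corner \<open>x\<close> and side \<open>h\<close> does not depend on
  the order of the two coordinates, whereas the mean value theorem, applied to one coordinate after
  the other, turns it into a mixed partial derivative taken in that order. Letting \<open>h\<close> tend to \<open>0\<close>
  identifies both mixed derivatives. The Hessian is needed in both index orders: trial steps see
  \<open>hess\<close> through its rows, derivatives along a line produce its columns.\<close>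

lemma mixed_difference:
  assumes f: "C_diff d (Suc (Suc k)) f" and x: "x \<in> euclid d"
    and ij: "i < d" "j < d" "i \<noteq> j" and h: "0 < h"
  shows "\<exists>\<theta>\<in>{0..1}. \<exists>\<theta>'\<in>{0..1}.
    f (x(i := x i + h, j := x j + h)) - f (x(i := x i + h)) - f (x(j := x j + h)) + f x
      = h * h * partial j (partial i f) (x(i := x i + \<theta> * h, j := x j + \<theta>' * h))"
proof -
  let ?x = "\<lambda>a b. x(i := a, j := b)"
  have sw: "?x a b = (x(j := b))(i := a)" for a b
    using ij by (simp add: fun_upd_twist)
  let ?\<phi> = "\<lambda>a. f (?x a (x j + h)) - f (?x a (x j))"
  have "\<exists>\<xi>>x i. \<xi> < x i + h \<and> ?\<phi> (x i + h) - ?\<phi> (x i)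
      = (x i + h - x i) * (partial i f (?x \<xi> (x j + h)) - partial i f (?x \<xi> (x j)))"
  proof (rule MVT2[where f = ?\<phi>])
    fix a
    show "((\<lambda>a. f (?x a (x j + h)) - f (?x a (x j))) has_real_derivative
        partial i f (?x a (x j + h)) - partial i f (?x a (x j))) (at a)"
      unfolding sw using ij x
      by (intro DERIV_diff partial_has_derivative[OF f]) auto
  qed (use h in simp)
  then obtain \<xi> where \<xi>: "x i < \<xi>" "\<xi> < x i + h"
    and 1: "(f (?x (x i + h) (x j + h)) - f (?x (x i + h) (x j)))
      - (f (?x (x i) (x j + h)) - f (?x (x i) (x j)))
      = h * (partial i f (?x \<xi> (x j + h)) - partial i f (?x \<xi> (x j)))"
    by auto
  obtain \<theta>' where \<theta>': "\<theta>' \<in> {0..1}"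
    and 2: "partial i f (?x \<xi> (x j + h)) - partial i f (?x \<xi> (x j))
      = h * partial j (partial i f) (?x \<xi> (x j + \<theta>' * h))"
    using mvt_coordinate[OF C_diff_partial[OF f ij(1)] ij(2), of "x(i := \<xi>)" "x j" h] x ij
    by auto
  have "\<xi> = x i + ((\<xi> - x i) / h) * h" "(\<xi> - x i) / h \<in> {0..1}"
    using h \<xi> by (auto simp: field_simps)
  moreover have "?x (x i + h) (x j) = x(i := x i + h)" "?x (x i) (x j) = x"
    "?x (x i) (x j + h) = x(j := x j + h)"
    using ij by auto
  ultimately show ?thesis
    using 1 2 \<theta>' by (intro bexI[of _ "(\<xi> - x i) / h"] bexI[of _ \<theta>']) auto
qed

lemma partial_commute:
  assumes f: "C_diff d (Suc (Suc k)) f" and x: "x \<in> euclid d" and ij: "i < d" "j < d"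
  shows "partial i (partial j f) x = partial j (partial i f) x"
proof (cases "i = j")
  case False
  define h where "h n = inverse (real (Suc n))" for n
  define M where "M n = f (x(i := x i + h n, j := x j + h n)) - f (x(i := x i + h n))
    - f (x(j := x j + h n)) + f x" for n
  have h_pos: "h n > 0" for n by (simp add: h_def)
  have h_nz: "h n \<noteq> 0" for n using h_pos[of n] by simp
  have h_lim: "h \<longlonglongrightarrow> 0" unfolding h_def by (rule LIMSEQ_inverse_real_of_nat)
  have lim: "(\<lambda>n. partial b (partial a f) (x(a := x a + \<theta> n * h n, b := x b + \<theta>' n * h n)))
      \<longlonglongrightarrow> partial b (partial a f) x"
    if ab: "a < d" "b < d" and \<theta>: "\<And>n. \<theta> n \<in> {0..1}" "\<And>n. \<theta>' n \<in> {0..1}" for a b \<theta> \<theta>'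
  proof -
    have small: "(\<lambda>n. \<theta> n * h n) \<longlonglongrightarrow> 0" if "\<And>n. \<theta> n \<in> {0..1}" for \<theta>
    proof (rule Lim_null_comparison[OF _ h_lim])
      show "\<forall>\<^sub>F n in sequentially. norm (\<theta> n * h n) \<le> h n"
        using that h_pos by (intro always_eventually) (simp add: abs_mult less_imp_le mult_left_le_one_le)
    qed
    have "(\<lambda>n. (x(a := x a + \<theta> n * h n, b := x b + \<theta>' n * h n)) c) \<longlonglongrightarrow> x c" for c
      using tendsto_add[OF tendsto_const small[of \<theta>], of "x a"]
        tendsto_add[OF tendsto_const small[of \<theta>'], of "x b"] \<theta>
      by (cases "c = b"; cases "c = a") auto
    then have "(\<lambda>n. x(a := x a + \<theta> n * h n, b := x b + \<theta>' n * h n)) \<longlonglongrightarrow> x"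
      by (rule tendsto_componentwise_fun)
    moreover have "continuous_on (euclid d) (partial b (partial a f))"
      using f ab by (intro C_diff_continuous[of d k]) simp
    moreover have "x(a := x a + \<theta> n * h n, b := x b + \<theta>' n * h n) \<in> euclid d" for n
      using x ab by simp
    ultimately show ?thesis
      using x by (intro continuous_on_tendsto_compose[of "euclid d" "partial b (partial a f)"]
          always_eventually allI)
  qed
  have "\<forall>n. \<exists>p. fst p \<in> {0..1} \<and> snd p \<in> {0..1} \<and> M n
      = h n * h n * partial j (partial i f) (x(i := x i + fst p * h n, j := x j + snd p * h n))" (is "\<forall>n. ?P n")
  proof
    fix n
    from mixed_difference[OF f x ij False h_pos[of n]] obtain a b where
      "a \<in> {0..1}" "b \<in> {0..1}" "M n
        = h n * h n * partial j (partial i f) (x(i := x i + a * h n, j := x j + b * h n))"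
      unfolding M_def by blast
    then show "?P n" by (intro exI[of _ "(a, b)"]) (simp only: fst_conv snd_conv)
  qed
  from choice[OF this] obtain p where p: "\<forall>n. fst (p n) \<in> {0..1} \<and> snd (p n) \<in> {0..1} \<and>
    M n = h n * h n *
      partial j (partial i f) (x(i := x i + fst (p n) * h n, j := x j + snd (p n) * h n))" ..
  have M_sym: "M n = f (x(j := x j + h n, i := x i + h n)) - f (x(j := x j + h n))
    - f (x(i := x i + h n)) + f x" for n
    by (simp add: M_def fun_upd_twist[OF False])
  have "\<forall>n. \<exists>p. fst p \<in> {0..1} \<and> snd p \<in> {0..1} \<and> M n
      = h n * h n * partial i (partial j f) (x(j := x j + fst p * h n, i := x i + snd p * h n))" (is "\<forall>n. ?P n")
  proof
    fix n
    from mixed_difference[OF f x ij(2,1) False[symmetric] h_pos[of n]] obtain a b where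
      "a \<in> {0..1}" "b \<in> {0..1}" "M n
        = h n * h n * partial i (partial j f) (x(j := x j + a * h n, i := x i + b * h n))"
      unfolding M_sym by blast
    then show "?P n" by (intro exI[of _ "(a, b)"]) (simp only: fst_conv snd_conv)
  qed
  from choice[OF this] obtain q where q: "\<forall>n. fst (q n) \<in> {0..1} \<and> snd (q n) \<in> {0..1} \<and>
    M n = h n * h n *
      partial i (partial j f) (x(j := x j + fst (q n) * h n, i := x i + snd (q n) * h n))" ..
  have "(\<lambda>n. M n / (h n * h n)) = (\<lambda>n.
      partial j (partial i f) (x(i := x i + fst (p n) * h n, j := x j + snd (p n) * h n)))"
    using p h_nz by (intro ext) (simp del: fun_upd_apply)
  then have "(\<lambda>n. M n / (h n * h n)) \<longlonglongrightarrow> partial j (partial i f) x"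
    using lim[OF ij, of "\<lambda>n. fst (p n)" "\<lambda>n. snd (p n)"] p by simp
  moreover have "(\<lambda>n. M n / (h n * h n)) = (\<lambda>n.
      partial i (partial j f) (x(j := x j + fst (q n) * h n, i := x i + snd (q n) * h n)))"
    using q h_nz by (intro ext) (simp del: fun_upd_apply)
  then have "(\<lambda>n. M n / (h n * h n)) \<longlonglongrightarrow> partial i (partial j f) x"
    using lim[OF ij(2,1), of "\<lambda>n. fst (q n)" "\<lambda>n. snd (q n)"] q by simp
  ultimately show ?thesis
    by (metis LIMSEQ_unique)
qed simp

section \<open>Euclidean and tensor norms\<close>

definition ip :: "nat \<Rightarrow> vect \<Rightarrow> vect \<Rightarrow> real"
  where "ip d u v = (\<Sum>i<d. u i * v i)"

lemma vnorm_nonneg [simp]: "0 \<le> vnorm d u"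
  by (simp add: vnorm_def)

lemma vnorm_power2: "(vnorm d u)\<^sup>2 = ip d u u"
  by (simp add: vnorm_def L2_set_def ip_def sum_nonneg power2_eq_square)

lemma vnorm_triangle: "vnorm d (\<lambda>i. u i + v i) \<le> vnorm d u + vnorm d v"
  by (simp add: vnorm_def L2_set_triangle_ineq)

lemma vnorm_scale: "vnorm d (\<lambda>i. c * u i) = \<bar>c\<bar> * vnorm d u"
proof -
  have "vnorm d (\<lambda>i. c * u i) = sqrt (c\<^sup>2 * (\<Sum>i<d. (u i)\<^sup>2))"
    by (simp add: vnorm_def L2_set_def power_mult_distrib sum_distrib_left)
  then show ?thesis
    by (simp add: real_sqrt_mult vnorm_def L2_set_def)
qed

lemma ip_linear:
  "ip d (\<lambda>i. u i + v i) w = ip d u w + ip d v w"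
  "ip d (\<lambda>i. u i - v i) w = ip d u w - ip d v w"
  "ip d (\<lambda>i. c * u i) w = c * ip d u w"
  by (simp_all add: ip_def distrib_right left_diff_distrib sum.distrib sum_subtractf
      sum_distrib_left mult.assoc)

lemma ip_le: "\<bar>ip d u v\<bar> \<le> vnorm d u * vnorm d v"
proof -
  have "\<bar>ip d u v\<bar> \<le> (\<Sum>i<d. \<bar>u i\<bar> * \<bar>v i\<bar>)"
    unfolding ip_def by (rule order.trans[OF sum_abs]) (simp add: abs_mult)
  also have "\<dots> \<le> vnorm d u * vnorm d v"
    unfolding vnorm_def by (rule L2_set_mult_ineq)
  finally show ?thesis .
qed

text \<open>Allows a norm to be bounded through scalar functions, to which the one-dimensional Taylor formula
  applies.\<close>

lemma vnorm_le_dual: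
  assumes "0 \<le> b" and "\<And>v. v \<in> euclid d \<Longrightarrow> ip d y v \<le> b * vnorm d v"
  shows "vnorm d y \<le> b"
proof (cases "vnorm d y = 0")
  case False
  define v where "v = (\<lambda>i. if i < d then y i else 0)"
  have v: "v \<in> euclid d" by (auto simp: v_def euclid_def)
  have "ip d y v = ip d y y" "vnorm d v = vnorm d y"
    by (auto simp: v_def ip_def vnorm_def L2_set_def)
  then have "(vnorm d y)\<^sup>2 \<le> b * vnorm d y"
    using assms(2)[OF v] by (simp add: vnorm_power2)
  moreover have "vnorm d y > 0" using False vnorm_nonneg[of d y] by linarith
  ultimately show ?thesis by (simp add: power2_eq_square)
qed (use assms in simp)

lemma abs_le_vnorm: "i < d \<Longrightarrow> \<bar>u i\<bar> \<le> vnorm d u"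
  unfolding vnorm_def using member_le_L2_set[of "{..<d}" i "\<lambda>i. \<bar>u i\<bar>"]
  by (simp add: L2_set_def)

lemma tensor_app_scale:
  "tensor_app d T (\<lambda>i. a * u i) (\<lambda>i. b * v i) (\<lambda>i. c * w i) = a * b * c * tensor_app d T u v w"
  by (simp add: tensor_app_def sum_distrib_left mult_ac)

text \<open>A real supremum says nothing unless it is taken over a bounded set; on the unit sphere the sum of
  the absolute values of all entries is a bound. Rescaling to unit vectors then gives the estimate.\<close>

lemma tensor_app_le:
  assumes "u \<in> euclid d" "v \<in> euclid d" "w \<in> euclid d"
  shows "\<bar>tensor_app d T u v w\<bar> \<le> tensor_norm d T * (vnorm d u * vnorm d v * vnorm d w)"
proof (cases "vnorm d u = 0 \<or> vnorm d v = 0 \<or> vnorm d w = 0")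
  case True
  have zero: "z i = 0" if "vnorm d z = 0" "i < d" for z i
    using abs_le_vnorm[OF that(2), of z] that(1) by simp
  have "tensor_app d T u v w = 0"
    unfolding tensor_app_def
    by (intro sum.neutral ballI) (use True zero in auto)
  then show ?thesis using True by auto
next
  case False
  define n where "n z = (\<lambda>i. inverse (vnorm d z) * z i)" for z
  have sphere: "n z \<in> usphere d" if "z \<in> euclid d" "vnorm d z \<noteq> 0" for z
    using that by (simp add: usphere_def n_def vnorm_scale euclid_def)
  have unscale: "(\<lambda>i. vnorm d z * n z i) = z" if "vnorm d z \<noteq> 0" for z
    using that by (auto simp: n_def)
  have "\<bar>tensor_app d T u v w\<bar> \<le> (\<Sum>i<d. \<Sum>j<d. \<Sum>k<d. \<bar>T i j k\<bar>)"
    if "u \<in> usphere d" "v \<in> usphere d" "w \<in> usphere d" for u v w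
    unfolding tensor_app_def
  proof (rule order.trans[OF sum_abs], rule sum_mono,
      rule order.trans[OF sum_abs], rule sum_mono,
      rule order.trans[OF sum_abs], rule sum_mono)
    fix i j k assume "i \<in> {..<d}" "j \<in> {..<d}" "k \<in> {..<d}"
    then have "\<bar>u i\<bar> \<le> 1" "\<bar>v j\<bar> \<le> 1" "\<bar>w k\<bar> \<le> 1"
      using that abs_le_vnorm[of i d u] abs_le_vnorm[of j d v] abs_le_vnorm[of k d w]
      by (simp_all add: usphere_def)
    then have "\<bar>u i\<bar> * \<bar>v j\<bar> * \<bar>w k\<bar> \<le> 1"
      by (intro mult_le_one) auto
    then show "\<bar>T i j k * u i * v j * w k\<bar> \<le> \<bar>T i j k\<bar>"
      using mult_left_mono[of _ 1 "\<bar>T i j k\<bar>"] by (simp add: abs_mult mult.assoc)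
  qed
  then have bdd: "bdd_above ((\<lambda>(u, v, w). \<bar>tensor_app d T u v w\<bar>)
      ` (usphere d \<times> usphere d \<times> usphere d))"
    by (intro bdd_aboveI2) auto
  have nz: "vnorm d u \<noteq> 0" "vnorm d v \<noteq> 0" "vnorm d w \<noteq> 0"
    using False by auto
  have "(n u, n v, n w) \<in> usphere d \<times> usphere d \<times> usphere d"
    using sphere assms False by simp
  from cSUP_upper[OF this bdd]
  have "\<bar>tensor_app d T (n u) (n v) (n w)\<bar> \<le> tensor_norm d T"
    by (simp add: tensor_norm_def)
  then have "(vnorm d u * vnorm d v * vnorm d w) * \<bar>tensor_app d T (n u) (n v) (n w)\<bar>
      \<le> (vnorm d u * vnorm d v * vnorm d w) * tensor_norm d T"
    by (intro mult_left_mono) auto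
  moreover have "tensor_app d T u v w
      = vnorm d u * vnorm d v * vnorm d w * tensor_app d T (n u) (n v) (n w)"
    using tensor_app_scale[of d T "vnorm d u" "n u" "vnorm d v" "n v" "vnorm d w" "n w"]
    by (simp only: unscale[OF nz(1)] unscale[OF nz(2)] unscale[OF nz(3)])
  ultimately show ?thesis
    by (simp only: abs_mult abs_of_nonneg vnorm_nonneg mult.commute)
qed

lemma psd_add_id:
  "psd d (add_id A c) \<longleftrightarrow> (\<forall>v\<in>euclid d. 0 \<le> ip d (mat_vec d A v) v + c * (vnorm d v)\<^sup>2)"
proof -
  have "mat_vec d (add_id A c) v i = mat_vec d A v i + c * v i" if "i < d" for v i
  proof -
    have "mat_vec d (add_id A c) v i = (\<Sum>j<d. A i j * v j + (if j = i then c * v j else 0))"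
      unfolding mat_vec_def add_id_def by (intro sum.cong) (auto simp: distrib_right)
    also have "\<dots> = mat_vec d A v i + c * v i"
      using that by (simp add: sum.distrib mat_vec_def)
    finally show ?thesis .
  qed
  then have "(\<Sum>i<d. v i * mat_vec d (add_id A c) v i)
      = ip d (mat_vec d A v) v + c * (vnorm d v)\<^sup>2" for v
    unfolding vnorm_power2 ip_def
    by (simp add: distrib_left sum.distrib sum_distrib_left mult_ac)
  then show ?thesis by (simp add: psd_def)
qed

section \<open>Taylor bounds\<close>

lemma gradient_along_line:
  assumes f: "C_diff d 3 f" and x: "x \<in> euclid d" and s: "s \<in> euclid d"
  shows "((\<lambda>t. ip d (grad f (\<lambda>j. x j + t * s j)) v) has_real_derivative
    ip d (mat_vec d (hess f (\<lambda>j. x j + t * s j)) s) v) (at t)"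
proof -
  let ?l = "\<lambda>t j. x j + t * s j"
  have f3: "C_diff d (Suc (Suc (Suc 0))) f" using f by (simp only: numeral_3_eq_3)
  have "((\<lambda>t. \<Sum>k<d. partial k f (?l t) * v k) has_real_derivative
      (\<Sum>k<d. (\<Sum>j<d. s j * partial j (partial k f) (?l t)) * v k)) (at t)"
    by (intro DERIV_sum DERIV_cmult_right derivative_along_line[OF C_diff_partial[OF f3] x s]) simp
  moreover have "(\<Sum>j<d. s j * partial j (partial k f) (?l t)) = mat_vec d (hess f (?l t)) s k"
    if "k < d" for k
    unfolding mat_vec_def hess_def
    by (rule sum.cong[OF refl])
      (use that partial_commute[OF f3 euclid_line[OF x s] _ that] in \<open>simp add: mult.commute\<close>)
  ultimately show ?thesis by (simp add: ip_def grad_def)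
qed

lemma hessian_along_line:
  assumes f: "C_diff d 3 f" and x: "x \<in> euclid d" and s: "s \<in> euclid d"
  shows "((\<lambda>t. ip d (mat_vec d (hess f (\<lambda>j. x j + t * s j)) s) v) has_real_derivative
    tensor_app d (third f (\<lambda>j. x j + t * s j)) s v s) (at t)"
proof -
  let ?l = "\<lambda>t j. x j + t * s j"
  have f3: "C_diff d (Suc (Suc (Suc 0))) f" using f by (simp only: numeral_3_eq_3)
  have "((\<lambda>t. \<Sum>j<d. (\<Sum>k<d. partial j (partial k f) (?l t) * s k) * v j) has_real_derivative
      (\<Sum>j<d. (\<Sum>k<d. (\<Sum>i<d. s i * partial i (partial j (partial k f)) (?l t)) * s k) * v j)) (at t)"
    by (intro DERIV_sum DERIV_cmult_right
        derivative_along_line[OF C_diff_partial[OF C_diff_partial[OF f3]] x s]) simp_all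
  moreover have "(\<Sum>j<d. (\<Sum>k<d. (\<Sum>i<d. s i * partial i (partial j (partial k f)) (?l t)) * s k) * v j)
      = (\<Sum>j<d. \<Sum>k<d. \<Sum>i<d. third f (?l t) i j k * s i * v j * s k)"
    unfolding third_def by (simp add: sum_distrib_left sum_distrib_right mult_ac)
  also have "\<dots> = (\<Sum>j<d. \<Sum>i<d. \<Sum>k<d. third f (?l t) i j k * s i * v j * s k)"
    by (intro sum.cong refl sum.swap)
  also have "\<dots> = tensor_app d (third f (?l t)) s v s"
    unfolding tensor_app_def by (rule sum.swap)
  ultimately show ?thesis by (simp add: ip_def mat_vec_def hess_def)
qed

text \<open>The second derivative of \<open>t \<mapsto> \<langle>\<nabla>f (x + t s), v\<rangle>\<close> is the third derivative of \<open>f\<close> applied to \<open>s\<close>, \<open>v\<close>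
  and \<open>s\<close>, hence at most \<open>K \<parallel>s\<parallel>\<^sup>2 \<parallel>v\<parallel>\<close>.\<close>

lemma gradient_taylor:
  assumes f: "C_diff d 3 f" and x: "x \<in> euclid d" and s: "s \<in> euclid d"
    and K: "\<And>t. 0 \<le> t \<Longrightarrow> t \<le> 1 \<Longrightarrow> tensor_norm d (third f (\<lambda>j. x j + t * s j)) \<le> K" "0 \<le> K"
    and \<tau>: "0 \<le> \<tau>" "\<tau> \<le> 1"
  shows "vnorm d (\<lambda>i. grad f (\<lambda>j. x j + \<tau> * s j) i - (grad f x i + \<tau> * mat_vec d (hess f x) s i))
    \<le> K / 2 * (vnorm d s)\<^sup>2"
proof (cases "\<tau> = 0")
  case True
  then show ?thesis using K by (simp add: vnorm_def L2_set_def)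
next
  case False
  let ?l = "\<lambda>t j. x j + t * s j" and ?r = "vnorm d s"
  show ?thesis
  proof (rule vnorm_le_dual)
    fix v assume v: "v \<in> euclid d"
    define D where "D m t = (if m = 0 then ip d (grad f (?l t)) v
      else if m = 1 then ip d (mat_vec d (hess f (?l t)) s) v
      else tensor_app d (third f (?l t)) s v s)" for m :: nat and t :: real
    have D: "D 0 = (\<lambda>t. ip d (grad f (?l t)) v)"
      "D (Suc 0) = (\<lambda>t. ip d (mat_vec d (hess f (?l t)) s) v)"
      "D (Suc (Suc 0)) = (\<lambda>t. tensor_app d (third f (?l t)) s v s)"
      by (auto simp: D_def)
    have "\<exists>t>0. t < \<tau> \<and> D 0 \<tau> = (\<Sum>m<2. D m 0 / fact m * \<tau> ^ m) + D 2 t / fact 2 * \<tau> ^ 2"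
    proof (rule Maclaurin[where diff = D])
      show "\<forall>m t. m < 2 \<and> 0 \<le> t \<and> t \<le> \<tau> \<longrightarrow> (D m has_real_derivative D (Suc m) t) (at t)"
        using gradient_along_line[OF f x s] hessian_along_line[OF f x s]
        by (auto simp: D less_Suc_eq numeral_2_eq_2)
    qed (use False \<tau> in auto)
    then obtain t where t: "0 < t" "t < \<tau>"
      and eq: "D 0 \<tau> = D 0 0 + D 1 0 * \<tau> + D 2 t / 2 * \<tau>\<^sup>2"
      by (auto simp: numeral_2_eq_2)
    have "\<bar>D 2 t\<bar> \<le> K * (?r * vnorm d v * ?r)"
      unfolding D_def using t \<tau> K(1)[of t] mult_right_mono[OF K(1)[of t], of "?r * vnorm d v * ?r"]
        tensor_app_le[OF s v s, of "third f (?l t)"] by simp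
    moreover have "\<tau>\<^sup>2 \<le> 1" using \<tau> by (simp add: power_le_one)
    then have "D 2 t / 2 * \<tau>\<^sup>2 \<le> \<bar>D 2 t\<bar> / 2 * 1"
      by (intro mult_mono) auto
    moreover have "ip d (\<lambda>i. grad f (?l \<tau>) i - (grad f x i + \<tau> * mat_vec d (hess f x) s i)) v
        = D 0 \<tau> - (D 0 0 + D 1 0 * \<tau>)"
      by (simp add: D_def ip_linear)
    ultimately show "ip d (\<lambda>i. grad f (?l \<tau>) i - (grad f x i + \<tau> * mat_vec d (hess f x) s i)) v
        \<le> K / 2 * ?r\<^sup>2 * vnorm d v"
      unfolding eq by (simp add: power2_eq_square mult_ac)
  qed (use K in simp)
qed

lemma value_taylor:
  assumes f: "C_diff d 3 f" and x: "x \<in> euclid d" and s: "s \<in> euclid d"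
    and K: "\<And>t. 0 \<le> t \<Longrightarrow> t \<le> 1 \<Longrightarrow> tensor_norm d (third f (\<lambda>j. x j + t * s j)) \<le> K"
  shows "f (vadd x s) - f x
    \<le> ip d (grad f x) s + ip d (mat_vec d (hess f x) s) s / 2 + K / 6 * vnorm d s ^ 3"
proof -
  let ?l = "\<lambda>t j. x j + t * s j" and ?r = "vnorm d s"
  define D where "D m t = (if m = 0 then f (?l t) else if m = 1 then ip d (grad f (?l t)) s
    else if m = 2 then ip d (mat_vec d (hess f (?l t)) s) s
    else tensor_app d (third f (?l t)) s s s)" for m :: nat and t :: real
  have f3: "C_diff d (Suc (Suc (Suc 0))) f" using f by (simp only: numeral_3_eq_3)
  have D: "D 0 = (\<lambda>t. f (?l t))" "D (Suc 0) = (\<lambda>t. ip d (grad f (?l t)) s)"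
    "D (Suc (Suc 0)) = (\<lambda>t. ip d (mat_vec d (hess f (?l t)) s) s)"
    "D (Suc (Suc (Suc 0))) = (\<lambda>t. tensor_app d (third f (?l t)) s s s)"
    by (auto simp: D_def)
  have "\<exists>t>0. t < 1 \<and> D 0 1 = (\<Sum>m<3. D m 0 / fact m * 1 ^ m) + D 3 t / fact 3 * 1 ^ 3"
  proof (rule Maclaurin[where diff = D])
    have "(D 0 has_real_derivative D (Suc 0) t) (at t)" for t
      using derivative_along_line[OF f3 x s, of t] by (simp add: D ip_def grad_def mult.commute)
    then show "\<forall>m t. m < 3 \<and> 0 \<le> t \<and> t \<le> 1 \<longrightarrow> (D m has_real_derivative D (Suc m) t) (at t)"
      using gradient_along_line[OF f x s] hessian_along_line[OF f x s]
      by (auto simp: D less_Suc_eq numeral_3_eq_3)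
  qed auto
  then obtain t where t: "0 < t" "t < 1" and eq: "D 0 1 = D 0 0 + D 1 0 + D 2 0 / 2 + D 3 t / 6"
    by (auto simp: numeral_3_eq_3 numeral_2_eq_2)
  have "D 3 t \<le> K * ?r ^ 3"
    unfolding D_def using t mult_right_mono[OF K[of t], of "?r ^ 3"]
      tensor_app_le[OF s s s, of "third f (?l t)"] by (simp add: power3_eq_cube)
  with eq show ?thesis
    by (simp add: D_def vadd_def)
qed

section \<open>Trial steps with a large regularization parameter are accepted\<close>

text \<open>The consequences of the two defining inequalities of a trial step in the form in which they
  are combined with Taylor's formula: the model value is obtained by pairing the residual with \<open>s\<close>.\<close>

lemma trial_step_residual:
  assumes "trial_step d f \<sigma> x s"
  shows "ip d (grad f x) s + ip d (mat_vec d (hess f x) s) s \<le> - (11/12 * \<sigma> * vnorm d s ^ 3)"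
    and "vnorm d (\<lambda>i. grad f x i + mat_vec d (hess f x) s i)
      \<le> \<sigma> / 12 * (vnorm d s)\<^sup>2 + \<bar>\<sigma>\<bar> * (vnorm d s)\<^sup>2"
    and "0 \<le> ip d (mat_vec d (hess f x) s) s + 7/6 * \<sigma> * vnorm d s ^ 3"
proof -
  let ?r = "vnorm d s" and ?g = "grad f x" and ?H = "mat_vec d (hess f x) s"
  let ?e = "\<lambda>i. ?g i + ?H i + \<sigma> * ?r * s i"
  have e: "vnorm d ?e \<le> \<sigma> / 12 * ?r\<^sup>2" and s: "s \<in> euclid d"
    and p: "psd d (add_id (hess f x) (7 / 6 * \<sigma> * ?r))"
    using assms by (auto simp: trial_step_def)
  have "ip d ?e s = ip d ?g s + ip d ?H s + \<sigma> * ?r * ?r\<^sup>2"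
    unfolding vnorm_power2 by (simp only: ip_linear)
  moreover have "ip d ?e s \<le> \<sigma> / 12 * ?r\<^sup>2 * ?r"
    using ip_le[of d ?e s] mult_right_mono[OF e, of ?r] by auto
  ultimately show "ip d ?g s + ip d ?H s \<le> - (11/12 * \<sigma> * ?r ^ 3)"
    by (simp add: power2_eq_square power3_eq_cube)
  have "(\<lambda>i. ?g i + ?H i) = (\<lambda>i. ?e i + (- (\<sigma> * ?r)) * s i)"
    by auto
  then have "vnorm d (\<lambda>i. ?g i + ?H i) \<le> vnorm d ?e + vnorm d (\<lambda>i. (- (\<sigma> * ?r)) * s i)"
    using vnorm_triangle[of d ?e "\<lambda>i. (- (\<sigma> * ?r)) * s i"] by simp
  also have "\<dots> \<le> \<sigma> / 12 * ?r\<^sup>2 + \<bar>\<sigma>\<bar> * ?r\<^sup>2"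
    using e by (simp only: vnorm_scale) (simp add: abs_mult power2_eq_square)
  finally show "vnorm d (\<lambda>i. ?g i + ?H i) \<le> \<sigma> / 12 * ?r\<^sup>2 + \<bar>\<sigma>\<bar> * ?r\<^sup>2" .
  show "0 \<le> ip d ?H s + 7/6 * \<sigma> * ?r ^ 3"
    using p s by (auto simp: psd_add_id power2_eq_square power3_eq_cube mult.assoc)
qed

text \<open>If the third derivative is bounded along the step by some \<open>K \<le> \<sigma>\<close>, both acceptance conditions follow
  from Taylor's formula. Such a \<open>K\<close> has the form \<open>L0 + L1 G\<close>, where \<open>G\<close> is the largest gradient norm on
  the step, and \<open>G\<close> may exceed the gradient norm at \<open>x\<close> by far when the step is long compared with
  \<open>1 / sqrt L1\<close>. Long steps come from a large gradient or from strongly negative curvature, so a bound \<open>- M\<close>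
  on the curvature is what makes \<open>L1 \<parallel>s\<parallel>\<^sup>2 \<le> 1/4\<close> available; Taylor's formula for the gradient at the
  maximizing point then bounds \<open>K\<close> in terms of itself with the factor \<open>1/8\<close>.\<close>

lemma large_regularization_accepted:
  assumes f: "C_diff d 3 f" and x: "x \<in> euclid d" and L: "0 < L0" "0 \<le> L1"
    and third: "\<forall>x\<in>euclid d. tensor_norm d (third f x) \<le> L0 + L1 * vnorm d (grad f x)"
    and trial: "trial_step d f \<sigma> x s"
    and M: "0 \<le> M" "psd d (add_id (hess f x) M)"
    and \<sigma>: "12 * (L0 + L1 * vnorm d (grad f x) + sqrt L1 * M) \<le> \<sigma>"
  shows "acceptable d f \<sigma> x s"
proof -
  define r where "r = vnorm d s"
  define a where "a = vnorm d (grad f x)"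
  define l where "l t = (\<lambda>j. x j + t * s j)" for t
  let ?g = "grad f x" and ?H = "mat_vec d (hess f x) s"
  have s: "s \<in> euclid d" using trial by (simp add: trial_step_def)
  have r: "0 \<le> r" and a: "0 \<le> a" by (simp_all add: r_def a_def)
  have a_le: "L1 * a \<le> \<sigma> / 12" and M_le: "sqrt L1 * M \<le> \<sigma> / 12" and L0_le: "L0 \<le> \<sigma> / 12"
    and \<sigma>_pos: "0 < \<sigma>"
  proof -
    have "0 \<le> L1 * a" "0 \<le> sqrt L1 * M" using L a M by simp_all
    then show "L1 * a \<le> \<sigma> / 12" "sqrt L1 * M \<le> \<sigma> / 12" "L0 \<le> \<sigma> / 12" "0 < \<sigma>"
      using \<sigma>[folded a_def, unfolded distrib_left] L(1) by - linarith+
  qed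
  note res = trial_step_residual[OF trial, folded r_def]
  have curv: "0 \<le> ip d ?H s + M * r\<^sup>2"
    using M s by (simp add: psd_add_id r_def)
  have gs: "- ip d ?g s \<le> a * r"
    using ip_le[of d ?g s] by (simp add: a_def r_def)
  \<comment> \<open>Dividing the energy inequality by \<open>r\<close> leaves a quadratic inequality for \<open>z = sqrt L1 * r\<close>.\<close>
  have short: "L1 * r\<^sup>2 \<le> 1/4"
  proof (cases "r = 0")
    case False
    define z where "z = sqrt L1 * r"
    have z: "0 \<le> z" "z\<^sup>2 = L1 * r\<^sup>2" using L r by (simp_all add: z_def power_mult_distrib)
    have "r * (11/12 * \<sigma> * r\<^sup>2) \<le> r * (a + M * r)"
      using res(1) curv gs by (simp add: power2_eq_square power3_eq_cube algebra_simps)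
    then have "11/12 * \<sigma> * r\<^sup>2 \<le> a + M * r"
      using False r by simp
    then have "L1 * (11/12 * \<sigma> * r\<^sup>2) \<le> L1 * (a + M * r)"
      using L by (intro mult_left_mono) auto
    also have "\<dots> = L1 * a + (sqrt L1 * M) * z"
    proof -
      have "sqrt L1 * M * (sqrt L1 * r) = (sqrt L1 * sqrt L1) * (M * r)"
        by (simp only: mult_ac)
      then show ?thesis using L by (simp add: z_def distrib_left)
    qed
    also have "\<dots> \<le> \<sigma> / 12 + \<sigma> / 12 * z"
      using a_le mult_right_mono[OF M_le z(1)] by linarith
    finally have "\<sigma> * (11 * z\<^sup>2) \<le> \<sigma> * (1 + z)"
      unfolding z(2) by (simp add: algebra_simps)
    then have "11 * z\<^sup>2 \<le> 1 + z" using \<sigma>_pos by simp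
    then have "z \<le> 1/2"
    proof (rule contrapos_pp)
      assume "\<not> z \<le> 1/2"
      then have "z * (1/2) < z * z" by (intro mult_strict_left_mono) auto
      then show "\<not> 11 * z\<^sup>2 \<le> 1 + z" using \<open>\<not> z \<le> 1/2\<close>
        unfolding power2_eq_square by linarith
    qed
    then have "z\<^sup>2 \<le> (1/2)\<^sup>2" using z by (intro power_mono)
    then show ?thesis using z by (simp add: power2_eq_square)
  qed simp
  have "continuous_on {0..1} (\<lambda>t. vnorm d (grad f (l t)))"
  proof -
    have "continuous_on {0..1} (\<lambda>t. partial i f (l t))" if "i < d" for i
    proof (rule continuous_on_compose2[of "euclid d" "partial i f"])
      show "continuous_on (euclid d) (partial i f)"
        using f that by (intro C_diff_continuous[of d 2]) (simp add: eval_nat_numeral)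
      show "continuous_on {0..1} l"
        unfolding l_def by (intro continuous_on_coordinatewise_then_product continuous_intros)
      show "l ` {0..1} \<subseteq> euclid d" using x s by (auto simp: l_def)
    qed
    then show ?thesis
      unfolding vnorm_def L2_set_def grad_def
      by (intro continuous_intros) auto
  qed
  then obtain \<tau> where \<tau>: "0 \<le> \<tau>" "\<tau> \<le> 1"
    and max: "\<And>t. 0 \<le> t \<Longrightarrow> t \<le> 1 \<Longrightarrow> vnorm d (grad f (l t)) \<le> vnorm d (grad f (l \<tau>))"
    using continuous_attains_sup[of "{0..1::real}" "\<lambda>t. vnorm d (grad f (l t))"] by auto
  define K where "K = L0 + L1 * vnorm d (grad f (l \<tau>))"
  have K: "tensor_norm d (third f (\<lambda>j. x j + t * s j)) \<le> K" if "0 \<le> t" "t \<le> 1" for t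
  proof -
    have "tensor_norm d (third f (l t)) \<le> L0 + L1 * vnorm d (grad f (l t))"
      using third x s by (simp add: l_def)
    also have "\<dots> \<le> K" unfolding K_def using max[OF that] L by (simp add: mult_left_mono)
    finally show ?thesis by (simp add: l_def)
  qed
  have K_pos: "0 \<le> K" using L by (simp add: K_def)
  have model: "vnorm d (\<lambda>i. ?g i + ?H i) \<le> 13/12 * \<sigma> * r\<^sup>2"
    using res(2) \<sigma>_pos by simp
  have near: "vnorm d (grad f (l t)) \<le> vnorm d (\<lambda>i. ?g i + t * ?H i) + K / 2 * r\<^sup>2"
    if "0 \<le> t" "t \<le> 1" for t
    using gradient_taylor[OF f x s K K_pos that]
      vnorm_triangle[of d "\<lambda>i. ?g i + t * ?H i" "\<lambda>i. grad f (l t) i - (?g i + t * ?H i)"]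
    by (simp add: r_def l_def)
  \<comment> \<open>Interpolating between \<open>?g\<close> and \<open>?g + ?H\<close> avoids any bound on the norm of the Hessian.\<close>
  have "vnorm d (\<lambda>i. ?g i + \<tau> * ?H i) \<le> (1 - \<tau>) * a + \<tau> * (13/12 * \<sigma> * r\<^sup>2)"
  proof -
    have "(\<lambda>i. ?g i + \<tau> * ?H i) = (\<lambda>i. (1 - \<tau>) * ?g i + \<tau> * (?g i + ?H i))"
      by (auto simp: algebra_simps)
    then have "vnorm d (\<lambda>i. ?g i + \<tau> * ?H i)
        \<le> vnorm d (\<lambda>i. (1 - \<tau>) * ?g i) + vnorm d (\<lambda>i. \<tau> * (?g i + ?H i))"
      using vnorm_triangle[of d "\<lambda>i. (1 - \<tau>) * ?g i" "\<lambda>i. \<tau> * (?g i + ?H i)"] by simp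
    also have "\<dots> = (1 - \<tau>) * a + \<tau> * vnorm d (\<lambda>i. ?g i + ?H i)"
      using \<tau> by (simp add: vnorm_scale a_def)
    finally show ?thesis
      using mult_left_mono[OF model \<tau>(1)] by linarith
  qed
  moreover have "(1 - \<tau>) * a \<le> a" "\<tau> * (13/12 * \<sigma> * r\<^sup>2) \<le> 13/12 * \<sigma> * r\<^sup>2"
    using \<tau> a \<sigma>_pos by (simp_all add: mult_left_le_one_le)
  ultimately have "vnorm d (grad f (l \<tau>)) \<le> a + 13/12 * \<sigma> * r\<^sup>2 + K / 2 * r\<^sup>2"
    using near[OF \<tau>] by linarith
  then have "L1 * vnorm d (grad f (l \<tau>)) \<le> L1 * (a + 13/12 * \<sigma> * r\<^sup>2 + K / 2 * r\<^sup>2)"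
    using L by (intro mult_left_mono)
  also have "\<dots> = L1 * a + (13/12 * \<sigma> + K / 2) * (L1 * r\<^sup>2)"
    by (simp add: algebra_simps)
  also have "\<dots> \<le> \<sigma> / 12 + (13/12 * \<sigma> + K / 2) * (1/4)"
    using a_le short \<sigma>_pos K_pos by (intro add_mono mult_left_mono) auto
  finally have "K - L0 \<le> \<sigma> / 12 + (13/12 * \<sigma> + K / 2) / 4"
    by (simp add: K_def)
  then have K_le: "K \<le> \<sigma>"
    using L0_le \<sigma>_pos by (simp add: field_simps)
  have end_point: "l 1 = vadd x s" by (auto simp: l_def vadd_def)
  have "f (vadd x s) - f x \<le> ip d ?g s + ip d ?H s / 2 + K / 6 * r ^ 3"
    using value_taylor[OF f x s K] by (simp add: r_def)
  also have "K / 6 * r ^ 3 \<le> \<sigma> / 6 * r ^ 3"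
    using K_le r by (intro mult_right_mono) auto
  finally have "f (vadd x s) - f x \<le> - (\<sigma> / 6 * r ^ 3)"
    using res(1,3) by simp
  moreover have "vnorm d (grad f (vadd x s)) \<le> 19/12 * \<sigma> * r\<^sup>2"
    using near[of 1] model mult_right_mono[OF K_le, of "r\<^sup>2"] by (simp add: end_point)
  ultimately show ?thesis
    by (simp add: acceptable_def r_def)
qed

section \<open>Counting the accepted steps\<close>

definition pos_log2 :: "real \<Rightarrow> real"
  where "pos_log2 z = max 0 (log 2 z)"

lemma pos_log2_nonneg [simp]: "0 \<le> pos_log2 z"
  by (simp add: pos_log2_def)

lemma log2_le_pos_log2: "log 2 z \<le> pos_log2 z"
  by (simp add: pos_log2_def)

lemma pos_log2_mono: "0 < a \<Longrightarrow> a \<le> b \<Longrightarrow> pos_log2 a \<le> pos_log2 b"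
  unfolding pos_log2_def by (intro max.mono) auto

lemma pos_log2_mult: "0 < a \<Longrightarrow> 0 < b \<Longrightarrow> pos_log2 (a * b) \<le> pos_log2 a + pos_log2 b"
  by (auto simp: pos_log2_def log_mult)

lemma pos_log2_half:
  assumes "2 \<le> z"
  shows "pos_log2 (z / 2) = pos_log2 z - 1"
proof -
  have "1 \<le> log 2 z" using assms by (simp add: le_log_iff)
  then show ?thesis using assms by (simp add: pos_log2_def log_divide)
qed

lemma pos_log2_ge_1: "2 \<le> z \<Longrightarrow> 1 \<le> pos_log2 z"
  using le_log_iff[of 2 z 1] by (simp add: pos_log2_def)

lemma inverse_ln2: "z / ln 2 \<le> 2 * z" if "0 \<le> z" for z :: real
proof -
  have "z * 1 \<le> z * (2 * ln 2)"
    using ln2_ge_two_thirds that by (intro mult_left_mono) auto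
  then show ?thesis by (simp add: field_simps)
qed

lemma pos_log2_1_plus: "0 \<le> z \<Longrightarrow> pos_log2 (1 + z) \<le> 2 * z"
proof -
  assume z: "0 \<le> z"
  have "ln (1 + z) / ln 2 \<le> z / ln 2"
    using ln_add_one_self_le_self[OF z] by (intro divide_right_mono) auto
  also have "\<dots> \<le> 2 * z" by (rule inverse_ln2[OF z])
  finally show ?thesis using z by (simp add: pos_log2_def log_def)
qed

text \<open>Bounding the regularization parameter by what forces it costs at most the factor
  \<open>6 * 84 ^ 3 = 3556224\<close>, attained when it is forced by curvature; one round number above it serves
  in every case.\<close>

definition \<kappa> :: real
  where "\<kappa> = 4000000"

lemma \<kappa>_pos [simp]: "0 < \<kappa>" "0 \<le> \<kappa>" "\<kappa> \<noteq> 0"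
  by (simp_all add: \<kappa>_def)

text \<open>What the accepted steps of a run tell about each other, stripped of all vectors: the \<open>k\<close>-th accepted
  step has length \<open>r k\<close> and regularization \<open>\<sigma> k\<close>, it lowers the objective by \<open>D k\<close>, and it starts from
  an iterate with gradient norm \<open>G k\<close>. The alternatives for \<open>\<sigma>\<close> distinguish whether the first trial
  of an iteration is accepted or the last trial before acceptance is rejected; in the latter case the
  curvature bound at the iterate is the one provided by the accepted step itself.\<close>

locale cubic_newton_progress =
  fixes L0 L1 \<Delta> \<sigma>init :: real and \<sigma> r D G :: "nat \<Rightarrow> real"
  assumes L0: "0 < L0" and L1: "0 \<le> L1" and \<sigma>init: "0 < \<sigma>init"
    and \<sigma>_pos: "0 < \<sigma> k" and r_nonneg: "0 \<le> r k" and G_nonneg: "0 \<le> G k"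
    and decrease: "\<sigma> k * r k ^ 3 / 6 \<le> D k"
    and total_decrease: "(\<Sum>k<n. D k) \<le> \<Delta>"
    and gradient: "G (Suc k) \<le> 19 / 12 * \<sigma> k * (r k)\<^sup>2"
    and first_regularization:
      "\<sigma> 0 \<le> \<sigma>init \<or> \<sigma> 0 \<le> 24 * (L0 + L1 * G 0 + sqrt L1 * (7 / 6 * \<sigma> 0 * r 0))"
    and regularization: "\<sigma> (Suc k) \<le> \<sigma> k / 2 \<or>
      \<sigma> (Suc k) \<le> 24 * (L0 + L1 * G (Suc k) + sqrt L1 * (7 / 6 * \<sigma> (Suc k) * r (Suc k)))"
begin

text \<open>This is \<open>L1 powr (3/2)\<close>.\<close>

definition P :: real
  where "P = L1 * sqrt L1"

definition K0 :: real
  where "K0 = L0 + P * \<Delta>"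

definition \<sigma>bar :: real
  where "\<sigma>bar = max \<sigma>init (4 * L1 * G 0)"

lemma P_nonneg: "0 \<le> P"
  using L1 by (simp add: P_def)

lemma D_nonneg: "0 \<le> D k"
  using decrease[of k] \<sigma>_pos[of k] r_nonneg[of k]
  by (meson divide_nonneg_pos mult_nonneg_nonneg less_imp_le order.trans zero_le_power zero_less_numeral)

lemma D_pair: "D k + D (Suc k) \<le> \<Delta>"
proof -
  have "D k + D (Suc k) \<le> (\<Sum>i<k. D i) + (D k + D (Suc k))"
    using D_nonneg by (simp add: sum_nonneg)
  also have "\<dots> = (\<Sum>i<Suc (Suc k). D i)" by simp
  finally show ?thesis using total_decrease[of "Suc (Suc k)"] by linarith
qed

lemma D_le: "D k \<le> \<Delta>"
  using D_pair[of k] D_nonneg[of "Suc k"] by linarith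

lemma \<Delta>_nonneg: "0 \<le> \<Delta>"
  using D_nonneg[of 0] D_le[of 0] by linarith

lemma K0_pos: "0 < K0"
  using L0 P_nonneg \<Delta>_nonneg by (simp add: K0_def add_pos_nonneg)

lemma gradient_cubed: "G (Suc k) ^ 3 \<le> 143 * \<sigma> k * (D k)\<^sup>2"
proof -
  have "G (Suc k) ^ 3 \<le> (19 / 12 * \<sigma> k * (r k)\<^sup>2) ^ 3"
    using gradient G_nonneg by (rule power_mono)
  also have "\<dots> = (19 / 12) ^ 3 * \<sigma> k * (\<sigma> k * r k ^ 3)\<^sup>2"
    by (simp add: power_mult_distrib power2_eq_square power3_eq_cube)
  also have "\<dots> \<le> (19 / 12) ^ 3 * \<sigma> k * (6 * D k)\<^sup>2"
    using decrease[of k] \<sigma>_pos[of k] r_nonneg[of k]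
    by (intro mult_left_mono power_mono) auto
  also have "\<dots> = (6859 / 48) * (\<sigma> k * (D k)\<^sup>2)"
    by (simp add: power2_eq_square power3_eq_cube)
  also have "\<dots> \<le> 143 * (\<sigma> k * (D k)\<^sup>2)"
    using \<sigma>_pos[of k] by (intro mult_right_mono) auto
  finally show ?thesis by simp
qed

lemma curvature_cubed: "(\<sigma> k * r k) ^ 3 \<le> 6 * (\<sigma> k)\<^sup>2 * D k"
proof -
  have "(\<sigma> k * r k) ^ 3 = (\<sigma> k)\<^sup>2 * (\<sigma> k * r k ^ 3)"
    by (simp add: power_mult_distrib power2_eq_square power3_eq_cube)
  also have "\<dots> \<le> (\<sigma> k)\<^sup>2 * (6 * D k)"
    using decrease[of k] by (intro mult_left_mono) auto
  finally show ?thesis by simp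
qed

text \<open>Regularization forced by curvature is paid for by the same step: the assumption says that \<open>sqrt L1 * r k\<close>
  is bounded below, so that \<open>\<sigma> k\<close> is at most a multiple of \<open>L1 powr (3/2) * \<sigma> k * r k ^ 3\<close>.\<close>

lemma curvature_regularization:
  assumes "\<sigma> k \<le> 84 * (sqrt L1 * \<sigma> k * r k)"
  shows "\<sigma> k \<le> \<kappa> * (P * D k)"
proof -
  have "\<sigma> k * 1 \<le> \<sigma> k * (84 * (sqrt L1 * r k))" using assms by (simp add: mult_ac)
  then have "1 \<le> 84 * (sqrt L1 * r k)"
    using \<sigma>_pos[of k] by (simp only: mult_le_cancel_left_pos)
  then have "1 ^ 3 \<le> (84 * (sqrt L1 * r k)) ^ 3"
    by (rule power_mono) simp
  also have "\<dots> = 592704 * P * r k ^ 3"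
    using L1 by (simp add: P_def power_mult_distrib power3_eq_cube)
  finally have "\<sigma> k * 1 \<le> \<sigma> k * (592704 * P * r k ^ 3)"
    using \<sigma>_pos[of k] by (intro mult_left_mono) auto
  also have "\<dots> = 592704 * P * (\<sigma> k * r k ^ 3)" by simp
  also have "\<dots> \<le> 592704 * P * (6 * D k)"
    using decrease[of k] P_nonneg by (intro mult_left_mono) auto
  also have "\<dots> = 3556224 * (P * D k)" by simp
  also have "\<dots> \<le> \<kappa> * (P * D k)"
    using P_nonneg D_nonneg by (intro mult_right_mono) (auto simp: \<kappa>_def)
  finally show ?thesis by simp
qed

text \<open>Regularization forced by a large gradient is paid for by the step that led there: a step with
  parameter at most comparable to \<open>L1\<close> times the gradient norm at its end point decreases the objective by at
  least a multiple of that gradient norm over \<open>sqrt L1\<close>.\<close>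

lemma gradient_regularization:
  assumes y: "y \<le> 72 * (L1 * G (Suc k))" and \<sigma>: "\<sigma> k \<le> 2 * y"
  shows "y \<le> \<kappa> * (P * D k)"
proof -
  define g where "g = G (Suc k)"
  have pos: "0 < L1 * g" using y \<sigma> \<sigma>_pos[of k] by (simp add: g_def)
  then have g: "0 < g" using L1 by (simp add: zero_less_mult_iff)
  have "g ^ 3 \<le> 143 * \<sigma> k * (D k)\<^sup>2"
    using gradient_cubed by (simp add: g_def)
  also have "\<dots> \<le> 143 * (144 * (L1 * g)) * (D k)\<^sup>2"
    using y \<sigma> by (intro mult_right_mono mult_left_mono) (auto simp: g_def)
  also have "\<dots> = g * (20592 * (L1 * (D k)\<^sup>2))" by simp
  finally have "g * g\<^sup>2 \<le> g * (20592 * (L1 * (D k)\<^sup>2))"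
    by (simp add: power2_eq_square power3_eq_cube)
  then have "g\<^sup>2 \<le> 20592 * (L1 * (D k)\<^sup>2)" using g by simp
  also have "\<dots> \<le> (144 * sqrt L1 * D k)\<^sup>2"
    using L1 by (simp add: power_mult_distrib)
  finally have "g \<le> 144 * sqrt L1 * D k"
    by (rule power2_le_imp_le) (use L1 D_nonneg in simp)
  then have "72 * L1 * g \<le> 72 * L1 * (144 * sqrt L1 * D k)"
    using L1 by (intro mult_left_mono) auto
  also have "\<dots> = 10368 * (P * D k)" by (simp add: P_def)
  also have "\<dots> \<le> \<kappa> * (P * D k)"
    using P_nonneg D_nonneg by (intro mult_right_mono) (auto simp: \<kappa>_def)
  finally show ?thesis using y by (simp add: g_def)
qed

text \<open>Apart from halving, the parameter can only reach values that are of order \<open>L0\<close> or paid for by the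
  decrease of two consecutive steps.\<close>

lemma regularization_bound:
  "\<sigma> (Suc k) \<le> \<sigma> k / 2 \<or> \<sigma> (Suc k) \<le> \<kappa> * (L0 + P * (D k + D (Suc k)))"
proof (cases "\<sigma> (Suc k) \<le> \<sigma> k / 2")
  case False
  let ?y = "\<sigma> (Suc k)"
  have "?y \<le> 24 * L0 + 24 * (L1 * G (Suc k)) + 28 * (sqrt L1 * ?y * r (Suc k))"
    using regularization[of k] False by (simp add: mult_ac distrib_left)
  \<comment> \<open>The largest of three summands is at least a third of their sum.\<close>
  then consider "?y \<le> 72 * L0" | "?y \<le> 72 * (L1 * G (Suc k))" | "?y \<le> 84 * (sqrt L1 * ?y * r (Suc k))"
    by linarith
  then have "?y \<le> \<kappa> * L0 \<or> ?y \<le> \<kappa> * (P * D k) \<or> ?y \<le> \<kappa> * (P * D (Suc k))"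
  proof cases
    case 1
    then show ?thesis using L0 by (simp add: \<kappa>_def)
  next
    case 2
    then show ?thesis using gradient_regularization[of ?y k] False by simp
  next
    case 3
    then show ?thesis using curvature_regularization by blast
  qed
  moreover have "0 \<le> \<kappa> * L0" "0 \<le> \<kappa> * (P * D k)" "0 \<le> \<kappa> * (P * D (Suc k))"
    using L0 P_nonneg D_nonneg by simp_all
  ultimately show ?thesis by (auto simp: distrib_left)
qed simp

lemma first_regularization_bound: "\<sigma> 0 \<le> \<kappa> * \<sigma>bar \<or> \<sigma> 0 \<le> \<kappa> * (L0 + P * D 0)"
proof -
  have bar: "\<sigma>init \<le> \<sigma>bar" "4 * L1 * G 0 \<le> \<sigma>bar" by (simp_all add: \<sigma>bar_def)
  have bar_pos: "0 < \<sigma>bar" using \<sigma>init bar by linarith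
  consider "\<sigma> 0 \<le> \<sigma>init" | "\<sigma> 0 \<le> 72 * L0" | "\<sigma> 0 \<le> 72 * (L1 * G 0)"
    | "\<sigma> 0 \<le> 84 * (sqrt L1 * \<sigma> 0 * r 0)"
  proof -
    have "\<sigma> 0 \<le> \<sigma>init \<or>
        \<sigma> 0 \<le> 24 * L0 + 24 * (L1 * G 0) + 28 * (sqrt L1 * \<sigma> 0 * r 0)"
      using first_regularization by (simp add: mult_ac distrib_left)
    then show ?thesis using that by linarith
  qed
  then show ?thesis
  proof cases
    case 1
    have "\<sigma>bar \<le> \<kappa> * \<sigma>bar" using bar_pos by (simp add: \<kappa>_def)
    then show ?thesis using 1 bar by linarith
  next
    case 2
    have "72 * L0 \<le> \<kappa> * L0" "0 \<le> \<kappa> * (P * D 0)"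
      using L0 P_nonneg D_nonneg by (simp_all add: \<kappa>_def)
    then show ?thesis using 2 by (simp add: distrib_left)
  next
    case 3
    have "18 * \<sigma>bar \<le> \<kappa> * \<sigma>bar" using bar_pos by (simp add: \<kappa>_def)
    then show ?thesis using 3 bar by linarith
  next
    case 4
    have "0 \<le> \<kappa> * L0" using L0 by simp
    then show ?thesis using curvature_regularization[OF 4] by (simp add: distrib_left)
  qed
qed

lemma \<sigma>bar_pos: "0 < \<sigma>bar"
  using \<sigma>init by (auto simp: \<sigma>bar_def)

lemma regularization_le: "\<sigma> k \<le> \<kappa> * max \<sigma>bar K0"
proof (induction k)
  case 0
  have "L0 + P * D 0 \<le> K0" unfolding K0_def using P_nonneg D_le by (simp add: mult_left_mono)
  then have "\<kappa> * (L0 + P * D 0) \<le> \<kappa> * max \<sigma>bar K0" "\<kappa> * \<sigma>bar \<le> \<kappa> * max \<sigma>bar K0"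
    by (simp_all add: le_max_iff_disj)
  then show ?case using first_regularization_bound by linarith
next
  case (Suc k)
  have "L0 + P * (D k + D (Suc k)) \<le> K0"
    unfolding K0_def using P_nonneg D_pair by (simp add: mult_left_mono)
  then have "\<kappa> * (L0 + P * (D k + D (Suc k))) \<le> \<kappa> * max \<sigma>bar K0"
    by (simp add: le_max_iff_disj)
  then show ?case using regularization_bound[of k] Suc \<sigma>_pos[of k] by linarith
qed

text \<open>An iteration is called big when its parameter is at least \<open>2 * \<kappa> * \<tau>\<close>. A halving
  never raises the logarithmic potential, and after a big iteration it lowers it by one unit. Without a
  halving the next potential is at most linear in the decrease, because \<open>log 2 (1 + z)\<close> is at most linear
  in \<open>z\<close>; the old potential then pays the unit for the current iteration.\<close>

lemma potential_step:
  assumes \<tau>: "L0 \<le> \<tau>"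
  shows "of_bool (2 * (\<kappa> * \<tau>) \<le> \<sigma> k) + pos_log2 (\<sigma> (Suc k) / (\<kappa> * \<tau>))
    \<le> pos_log2 (\<sigma> k / (\<kappa> * \<tau>)) + 2 * (P * (D k + D (Suc k)) / \<tau>)"
proof -
  let ?E = "P * (D k + D (Suc k)) / \<tau>" and ?z = "\<lambda>k. \<sigma> k / (\<kappa> * \<tau>)"
  have \<tau>_pos: "0 < \<tau>" and \<kappa>\<tau>: "0 < \<kappa> * \<tau>" using \<tau> L0 by simp_all
  have E: "0 \<le> ?E" using P_nonneg D_nonneg \<tau>_pos by simp
  have z: "0 < ?z k" for k using \<sigma>_pos \<kappa>\<tau> by simp
  have big: "2 * (\<kappa> * \<tau>) \<le> \<sigma> k \<longleftrightarrow> 2 \<le> ?z k" using \<kappa>\<tau> by (simp add: pos_le_divide_eq)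
  from regularization_bound[of k] show ?thesis
  proof
    assume "\<sigma> (Suc k) \<le> \<sigma> k / 2"
    then have "?z (Suc k) \<le> ?z k / 2"
      using divide_right_mono[of "\<sigma> (Suc k)" "\<sigma> k / 2" "\<kappa> * \<tau>"] \<kappa>\<tau> by simp
    then have half: "pos_log2 (?z (Suc k)) \<le> pos_log2 (?z k / 2)"
      by (rule pos_log2_mono[OF z])
    show ?thesis
    proof (cases "2 \<le> ?z k")
      case True
      then show ?thesis using half pos_log2_half[OF True] E big by simp
    next
      case False
      have "pos_log2 (?z k / 2) \<le> pos_log2 (?z k)"
        using z[of k] by (intro pos_log2_mono) auto
      then show ?thesis using half E False big by simp
    qed
  next
    assume "\<sigma> (Suc k) \<le> \<kappa> * (L0 + P * (D k + D (Suc k)))"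
    then have "?z (Suc k) \<le> \<kappa> * (L0 + P * (D k + D (Suc k))) / (\<kappa> * \<tau>)"
      using \<kappa>\<tau> by (intro divide_right_mono) auto
    also have "\<dots> = L0 / \<tau> + ?E" by (simp add: add_divide_distrib)
    also have "\<dots> \<le> 1 + ?E" using \<tau> \<tau>_pos by simp
    finally have "pos_log2 (?z (Suc k)) \<le> pos_log2 (1 + ?E)"
      by (rule pos_log2_mono[OF z])
    also have "\<dots> \<le> 2 * ?E" by (rule pos_log2_1_plus[OF E])
    finally have "pos_log2 (?z (Suc k)) \<le> 2 * ?E" .
    moreover have "of_bool (2 \<le> ?z k) \<le> pos_log2 (?z k)"
      using pos_log2_ge_1[of "?z k"] by simp
    ultimately show ?thesis using big by simp
  qed
qed

lemma sum_shifted_le: "(\<Sum>k<n. D (Suc k)) \<le> \<Delta>"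
  using total_decrease[of "Suc n"] D_nonneg[of 0] unfolding sum.lessThan_Suc_shift by linarith

text \<open>Comparing \<open>\<sigma>bar\<close> with \<open>\<tau>\<close> through the intermediate scale \<open>K0\<close> leaves only the logarithm of \<open>\<sigma>bar / K0\<close> as a start-up
  cost: the way from \<open>K0 = L0 + P * \<Delta>\<close> down to \<open>\<tau> \<ge> L0\<close> is again linear in the decrease.\<close>

lemma initial_potential:
  assumes \<tau>: "L0 \<le> \<tau>"
  shows "pos_log2 (\<sigma> 0 / (\<kappa> * \<tau>)) \<le> pos_log2 (\<sigma>bar / K0) + 2 * (P * \<Delta> / \<tau>)"
proof -
  have \<tau>_pos: "0 < \<tau>" and \<kappa>\<tau>: "0 < \<kappa> * \<tau>" using \<tau> L0 by simp_all
  have z: "0 < \<sigma> 0 / (\<kappa> * \<tau>)" using \<sigma>_pos \<kappa>\<tau> by simp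
  have E: "0 \<le> P * \<Delta> / \<tau>" using P_nonneg \<Delta>_nonneg \<tau>_pos by simp
  have K0_le: "K0 / \<tau> \<le> 1 + P * \<Delta> / \<tau>"
    using \<tau> \<tau>_pos by (simp add: K0_def add_divide_distrib)
  have log_K0: "pos_log2 (K0 / \<tau>) \<le> 2 * (P * \<Delta> / \<tau>)"
    using pos_log2_mono[OF _ K0_le] pos_log2_1_plus[OF E] K0_pos \<tau>_pos by fastforce
  from first_regularization_bound show ?thesis
  proof
    assume "\<sigma> 0 \<le> \<kappa> * \<sigma>bar"
    then have "\<sigma> 0 / (\<kappa> * \<tau>) \<le> \<kappa> * \<sigma>bar / (\<kappa> * \<tau>)"
      using \<kappa>\<tau> by (intro divide_right_mono) auto
    also have "\<dots> = (\<sigma>bar / K0) * (K0 / \<tau>)" using K0_pos by simp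
    finally have "pos_log2 (\<sigma> 0 / (\<kappa> * \<tau>)) \<le> pos_log2 ((\<sigma>bar / K0) * (K0 / \<tau>))"
      by (rule pos_log2_mono[OF z])
    also have "\<dots> \<le> pos_log2 (\<sigma>bar / K0) + pos_log2 (K0 / \<tau>)"
      using \<sigma>bar_pos K0_pos \<tau>_pos by (intro pos_log2_mult) auto
    finally show ?thesis using log_K0 by linarith
  next
    assume "\<sigma> 0 \<le> \<kappa> * (L0 + P * D 0)"
    also have "\<dots> \<le> \<kappa> * K0"
      unfolding K0_def using P_nonneg D_le by (simp add: mult_left_mono)
    finally have "\<sigma> 0 / (\<kappa> * \<tau>) \<le> \<kappa> * K0 / (\<kappa> * \<tau>)"
      using \<kappa>\<tau> by (intro divide_right_mono) auto
    then have "pos_log2 (\<sigma> 0 / (\<kappa> * \<tau>)) \<le> pos_log2 (K0 / \<tau>)"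
      using z by (intro pos_log2_mono) auto
    then show ?thesis using log_K0 pos_log2_nonneg[of "\<sigma>bar / K0"] by linarith
  qed
qed

lemma count_big:
  assumes \<tau>: "L0 \<le> \<tau>"
  shows "(\<Sum>k<n. of_bool (2 * (\<kappa> * \<tau>) \<le> \<sigma> k)) \<le> pos_log2 (\<sigma>bar / K0) + 6 * (P * \<Delta> / \<tau>)"
proof -
  let ?u = "\<lambda>k. pos_log2 (\<sigma> k / (\<kappa> * \<tau>))"
  let ?b = "\<lambda>n. \<Sum>k<n. of_bool (2 * (\<kappa> * \<tau>) \<le> \<sigma> k) :: real"
  define e where "e = P * \<Delta> / \<tau>"
  have \<tau>_pos: "0 < \<tau>" using \<tau> L0 by simp
  have "?b n + ?u n
      \<le> ?u 0 + (\<Sum>k<n. 2 * (P * (D k + D (Suc k)) / \<tau>))"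
  proof (induction n)
    case (Suc n)
    then show ?case using potential_step[OF \<tau>, of n] by simp
  qed simp
  moreover have "(\<Sum>k<n. 2 * (P * (D k + D (Suc k)) / \<tau>)) \<le> 4 * (P * \<Delta> / \<tau>)"
  proof -
    have "(\<Sum>k<n. 2 * (P * (D k + D (Suc k)) / \<tau>)) = (\<Sum>k<n. 2 * P / \<tau> * (D k + D (Suc k)))"
      by (intro sum.cong refl) simp
    also have "\<dots> = 2 * P / \<tau> * ((\<Sum>k<n. D k) + (\<Sum>k<n. D (Suc k)))"
      by (simp only: sum.distrib sum_distrib_left[symmetric])
    also have "\<dots> \<le> 2 * P / \<tau> * (\<Delta> + \<Delta>)"
      using total_decrease[of n] sum_shifted_le[of n] P_nonneg \<tau>_pos by (intro mult_left_mono) auto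
    finally show ?thesis by simp
  qed
  ultimately have "?b n + ?u n \<le> ?u 0 + 4 * e"
    unfolding e_def by (rule order.trans[OF _ add_left_mono])
  moreover have "?u 0 \<le> pos_log2 (\<sigma>bar / K0) + 2 * e"
    unfolding e_def by (rule initial_potential[OF \<tau>])
  ultimately show ?thesis
    using pos_log2_nonneg[of "\<sigma> n / (\<kappa> * \<tau>)"] unfolding e_def[symmetric] by linarith
qed

context
  fixes \<epsilon> \<delta> :: real
  assumes \<epsilon>: "0 < \<epsilon>" and \<delta>: "0 < \<delta>"
begin

definition rate :: real
  where "rate = sqrt L0 / \<epsilon> powr (3/2) + sqrt L1 / \<epsilon> + L0\<^sup>2 / \<delta> ^ 3 + L1 / \<delta>"

text \<open>The threshold is small enough that an iteration below it at a nonstationary point yields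
  the decrease that the complexity bound asks for, whichever of the two stationarity conditions fails,
  and large enough that \<open>P / \<tau>\<close>, the price of a unit of potential, is at most \<open>rate\<close>.\<close>

definition \<tau> :: real
  where "\<tau> = L0 + min (L1 * \<epsilon>) (sqrt L1 * \<delta>)"

lemma rate_parts:
  "0 \<le> sqrt L0 / \<epsilon> powr (3/2)" "0 \<le> sqrt L1 / \<epsilon>" "0 \<le> L0\<^sup>2 / \<delta> ^ 3" "0 \<le> L1 / \<delta>"
  using L0 L1 \<epsilon> \<delta> by simp_all

lemma rate_nonneg: "0 \<le> rate"
  using rate_parts by (simp add: rate_def)

lemma \<tau>_ge: "L0 \<le> \<tau>"
  using L1 \<epsilon> \<delta> by (simp add: \<tau>_def)

lemma P_over_\<tau>: "P / \<tau> \<le> rate"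
proof (cases "L1 * \<epsilon> \<le> sqrt L1 * \<delta>")
  case True
  then have \<tau>: "\<tau> = L0 + L1 * \<epsilon>" by (simp add: \<tau>_def)
  have "L1 * sqrt L1 * \<epsilon> \<le> sqrt L1 * \<tau>"
    using L0 L1 by (simp add: \<tau> distrib_left)
  then have "P / \<tau> \<le> sqrt L1 / \<epsilon>"
    using \<epsilon> \<tau>_ge L0 by (simp add: P_def divide_le_eq pos_le_divide_eq mult.commute)
  then show ?thesis using rate_parts unfolding rate_def by linarith
next
  case False
  then have \<tau>: "\<tau> = L0 + sqrt L1 * \<delta>" by (simp add: \<tau>_def)
  have "L1 * sqrt L1 * \<delta> \<le> L1 * \<tau>"
    using L0 L1 by (simp add: \<tau> distrib_left)
  then have "P / \<tau> \<le> L1 / \<delta>"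
    using \<delta> \<tau>_ge L0 by (simp add: P_def divide_le_eq pos_le_divide_eq mult.commute)
  then show ?thesis using rate_parts unfolding rate_def by linarith
qed

text \<open>Since \<open>\<sigma> k * r k\<close> exceeds a multiple of \<open>\<delta>\<close>, the decrease is at least of order \<open>\<delta> ^ 3 / (\<sigma> k)\<^sup>2\<close>, and the
  parameter is at most of order \<open>L0 + sqrt L1 * \<delta>\<close>.\<close>

lemma curvature_charge:
  assumes small: "\<sigma> k < 2 * (\<kappa> * \<tau>)" and neg: "\<delta> < 7 / 6 * \<sigma> k * r k"
  shows "1 \<le> 80 * \<kappa>\<^sup>2 * rate * D k"
proof -
  have "\<tau> \<le> L0 + sqrt L1 * \<delta>" by (simp add: \<tau>_def)
  then have "2 * (\<kappa> * \<tau>) \<le> 2 * (\<kappa> * (L0 + sqrt L1 * \<delta>))" by simp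
  with small have \<sigma>_le: "\<sigma> k \<le> 2 * (\<kappa> * (L0 + sqrt L1 * \<delta>))" by linarith
  have "\<delta> ^ 3 \<le> (7 / 6 * (\<sigma> k * r k)) ^ 3"
    using neg \<delta> by (intro power_mono) auto
  also have "\<dots> = 343 / 216 * (\<sigma> k * r k) ^ 3"
    by (simp add: power3_eq_cube)
  also have "\<dots> \<le> 343 / 216 * (6 * (\<sigma> k)\<^sup>2 * D k)"
    using curvature_cubed by (intro mult_left_mono) auto
  also have "\<dots> \<le> 10 * ((\<sigma> k)\<^sup>2 * D k)"
    using D_nonneg[of k] by simp
  also have "(\<sigma> k)\<^sup>2 * D k \<le> (2 * (\<kappa> * (L0 + sqrt L1 * \<delta>)))\<^sup>2 * D k"
    using \<sigma>_le \<sigma>_pos[of k] D_nonneg by (intro mult_right_mono power_mono) auto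
  also have "(2 * (\<kappa> * (L0 + sqrt L1 * \<delta>)))\<^sup>2 = 4 * \<kappa>\<^sup>2 * (L0 + sqrt L1 * \<delta>)\<^sup>2"
    by (simp add: power_mult_distrib)
  also have "(L0 + sqrt L1 * \<delta>)\<^sup>2 \<le> 2 * (L0\<^sup>2 + L1 * \<delta>\<^sup>2)"
  proof -
    have "0 \<le> (L0 - sqrt L1 * \<delta>)\<^sup>2" by simp
    moreover have "(sqrt L1 * \<delta>)\<^sup>2 = L1 * \<delta>\<^sup>2" using L1 by (simp add: power_mult_distrib)
    ultimately show ?thesis by (simp add: power2_sum power2_diff)
  qed
  finally have "\<delta> ^ 3 \<le> 10 * (4 * \<kappa>\<^sup>2 * (2 * (L0\<^sup>2 + L1 * \<delta>\<^sup>2)) * D k)"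
    using D_nonneg by (simp add: mult_left_mono mult_right_mono)
  then have "\<delta> ^ 3 / \<delta> ^ 3 \<le> 10 * (4 * \<kappa>\<^sup>2 * (2 * (L0\<^sup>2 + L1 * \<delta>\<^sup>2)) * D k) / \<delta> ^ 3"
    using \<delta> by (intro divide_right_mono) auto
  also have "\<dots> = 80 * \<kappa>\<^sup>2 * (L0\<^sup>2 / \<delta> ^ 3 + L1 / \<delta>) * D k"
    using \<delta> by (simp add: field_simps power2_eq_square power3_eq_cube)
  also have "\<dots> \<le> 80 * \<kappa>\<^sup>2 * rate * D k"
    using D_nonneg rate_parts by (intro mult_right_mono mult_left_mono) (auto simp: rate_def)
  finally show ?thesis using \<delta> by simp
qed

text \<open>By \<open>gradient_cubed\<close> the decrease is at least of order \<open>\<epsilon> powr (3/2) / sqrt (\<sigma> k)\<close>, and the parameter is at most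
  of order \<open>L0 + L1 * \<epsilon>\<close>.\<close>

lemma gradient_charge:
  assumes small: "\<sigma> k < 2 * (\<kappa> * \<tau>)" and large: "\<epsilon> < G (Suc k)"
  shows "1 \<le> 80 * \<kappa>\<^sup>2 * rate * D k"
proof -
  define e where "e = \<epsilon> powr (3/2)"
  define Y where "Y = sqrt L0 / e + sqrt L1 / \<epsilon>"
  have e: "0 < e" using \<epsilon> by (simp add: e_def)
  have e2: "e\<^sup>2 = \<epsilon> ^ 3"
    using \<epsilon> by (simp add: e_def powr_powr flip: powr_numeral powr_realpow)
  have "\<tau> \<le> L0 + L1 * \<epsilon>" by (simp add: \<tau>_def)
  then have "2 * (\<kappa> * \<tau>) \<le> 2 * (\<kappa> * (L0 + L1 * \<epsilon>))" by simp
  with small have \<sigma>_le: "\<sigma> k \<le> 2 * (\<kappa> * (L0 + L1 * \<epsilon>))" by linarith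
  have Y_parts: "0 \<le> sqrt L0 / e" "0 \<le> sqrt L1 / \<epsilon>" using rate_parts e L0 by simp_all
  have "\<epsilon> ^ 3 \<le> G (Suc k) ^ 3" using large \<epsilon> by (intro power_mono) auto
  also have "\<dots> \<le> 143 * \<sigma> k * (D k)\<^sup>2" by (rule gradient_cubed)
  also have "\<dots> \<le> 143 * (2 * (\<kappa> * (L0 + L1 * \<epsilon>))) * (D k)\<^sup>2"
    using \<sigma>_le by (intro mult_right_mono mult_left_mono) auto
  finally have "\<epsilon> ^ 3 / \<epsilon> ^ 3 \<le> 143 * (2 * (\<kappa> * (L0 + L1 * \<epsilon>))) * (D k)\<^sup>2 / \<epsilon> ^ 3"
    using \<epsilon> by (intro divide_right_mono) auto
  also have "\<dots> = 286 * \<kappa> * (D k)\<^sup>2 * (L0 / \<epsilon> ^ 3 + L1 / \<epsilon>\<^sup>2)"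
    using \<epsilon> by (simp add: field_simps power2_eq_square power3_eq_cube)
  also have "L0 / \<epsilon> ^ 3 + L1 / \<epsilon>\<^sup>2 = (sqrt L0 / e)\<^sup>2 + (sqrt L1 / \<epsilon>)\<^sup>2"
    using L0 L1 by (simp add: power_divide e2)
  also have "\<dots> \<le> Y\<^sup>2"
    using mult_nonneg_nonneg[OF Y_parts] by (simp add: Y_def power2_sum)
  also have "286 * \<kappa> * (D k)\<^sup>2 * Y\<^sup>2 \<le> (17 * \<kappa>)\<^sup>2 * (D k)\<^sup>2 * Y\<^sup>2"
    by (intro mult_right_mono) (simp_all add: \<kappa>_def)
  also have "\<dots> = (17 * \<kappa> * D k * Y)\<^sup>2" by (simp add: power_mult_distrib)
  finally have "1\<^sup>2 \<le> (17 * \<kappa> * D k * Y)\<^sup>2" using \<epsilon> by (simp add: mult_left_mono)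
  then have "1 \<le> 17 * \<kappa> * D k * Y"
    by (rule power2_le_imp_le) (use Y_parts D_nonneg in \<open>simp add: Y_def\<close>)
  also have "\<dots> = 17 * \<kappa> * (Y * D k)" by simp
  also have "\<dots> \<le> 80 * \<kappa>\<^sup>2 * (rate * D k)"
  proof (rule mult_mono)
    show "17 * \<kappa> \<le> 80 * \<kappa>\<^sup>2" by (simp add: \<kappa>_def)
    show "Y * D k \<le> rate * D k"
      using rate_parts D_nonneg by (intro mult_right_mono) (auto simp: rate_def Y_def e_def)
  qed (use Y_parts D_nonneg in \<open>simp_all add: Y_def\<close>)
  finally show ?thesis by (simp add: mult.assoc)
qed

text \<open>A failure of the gradient condition at iterate \<open>k + 1\<close> is charged to step \<open>k\<close>, a failure of the
  curvature condition at iterate \<open>k\<close> to step \<open>k\<close>; each step is thus charged at most twice. Iterate \<open>0\<close> has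
  no preceding step, whence the summand \<open>1\<close>.\<close>

lemma count_nonstationary:
  assumes nonstationary: "\<And>k. k < N \<Longrightarrow> \<epsilon> < G k \<or> \<delta> < 7 / 6 * \<sigma> k * r k"
  shows "real N \<le> 1 + 2 * pos_log2 (\<sigma>bar / K0) + 172 * \<kappa>\<^sup>2 * (rate * \<Delta>)"
proof -
  define b where "b k = of_bool (2 * (\<kappa> * \<tau>) \<le> \<sigma> k) + 80 * \<kappa>\<^sup>2 * rate * D k" for k
  have b_nonneg: "0 \<le> b k" for k
    using rate_nonneg D_nonneg by (simp add: b_def)
  have b_ge: "1 \<le> b k" if "\<epsilon> < G (Suc k) \<or> \<delta> < 7 / 6 * \<sigma> k * r k" for k
  proof (cases "2 * (\<kappa> * \<tau>) \<le> \<sigma> k")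
    case True
    then show ?thesis using rate_nonneg D_nonneg by (simp add: b_def)
  next
    case False
    then show ?thesis
      using that curvature_charge[of k] gradient_charge[of k] by (auto simp: b_def)
  qed
  have "real N \<le> 1 + 2 * (\<Sum>k<N. b k)"
  proof (cases N)
    case (Suc m)
    have "1 \<le> b k + b (Suc k)" if "k < m" for k
    proof -
      consider "\<epsilon> < G (Suc k)" | "\<delta> < 7 / 6 * \<sigma> (Suc k) * r (Suc k)"
        using nonstationary[of "Suc k"] \<open>k < m\<close> Suc by auto
      then show ?thesis
        using b_ge[of k] b_ge[of "Suc k"] b_nonneg[of k] b_nonneg[of "Suc k"] by cases auto
    qed
    then have "(\<Sum>k<m. 1) \<le> (\<Sum>k<m. b k + b (Suc k))"
      by (intro sum_mono) simp
    also have "\<dots> \<le> (\<Sum>k<Suc m. b k) + (\<Sum>k<Suc m. b k)"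
    proof -
      have "(\<Sum>k<m. b k) \<le> (\<Sum>k<Suc m. b k)" using b_nonneg by simp
      moreover have "(\<Sum>k<m. b (Suc k)) \<le> (\<Sum>k<Suc m. b k)"
        using b_nonneg[of 0] unfolding sum.lessThan_Suc_shift by linarith
      ultimately show ?thesis by (simp add: sum.distrib)
    qed
    finally show ?thesis by (simp add: Suc)
  qed simp
  moreover have "(\<Sum>k<N. b k) = (\<Sum>k<N. of_bool (2 * (\<kappa> * \<tau>) \<le> \<sigma> k)) + 80 * \<kappa>\<^sup>2 * rate * (\<Sum>k<N. D k)"
    unfolding b_def by (simp only: sum.distrib sum_distrib_left)
  moreover have "80 * \<kappa>\<^sup>2 * rate * (\<Sum>k<N. D k) \<le> 80 * \<kappa>\<^sup>2 * rate * \<Delta>"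
    using total_decrease rate_nonneg by (intro mult_left_mono) auto
  moreover have "P * \<Delta> / \<tau> \<le> rate * \<Delta>"
    using mult_right_mono[OF P_over_\<tau> \<Delta>_nonneg] by simp
  moreover have "12 * (rate * \<Delta>) \<le> 12 * \<kappa>\<^sup>2 * (rate * \<Delta>)"
    using rate_nonneg \<Delta>_nonneg by (intro mult_right_mono) (auto simp: \<kappa>_def)
  moreover have "80 * \<kappa>\<^sup>2 * rate * \<Delta> = 80 * (\<kappa>\<^sup>2 * (rate * \<Delta>))"
    "12 * \<kappa>\<^sup>2 * (rate * \<Delta>) = 12 * (\<kappa>\<^sup>2 * (rate * \<Delta>))"
    "172 * \<kappa>\<^sup>2 * (rate * \<Delta>) = 172 * (\<kappa>\<^sup>2 * (rate * \<Delta>))"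
    by simp_all
  ultimately show ?thesis
    using count_big[OF \<tau>_ge, of N] by linarith
qed

text \<open>The left-hand side is the number of oracle calls made when iterate \<open>N\<close> is reached; \<open>\<sigma> m / 2\<close> is the
  regularization parameter at that time. The constant is three times the one in
  \<open>count_nonstationary\<close>; the logarithmic terms come with much smaller coefficients.\<close>

theorem oracle_calls_le:
  assumes nonstationary: "\<And>k. k < N \<Longrightarrow> \<epsilon> < G k \<or> \<delta> < 7 / 6 * \<sigma> k * r k"
    and N: "N = Suc m"
  shows "1 + 3 * real N + log 2 (\<sigma> m / 2 / \<sigma>init)
    \<le> 516 * \<kappa>\<^sup>2 * (\<Delta> * rate + max 1 \<lceil>log 2 (\<sigma>bar / K0)\<rceil> + max (ln (K0 / \<sigma>init)) 0)"
proof -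
  let ?k0 = "real_of_int (max 1 \<lceil>log 2 (\<sigma>bar / K0)\<rceil>)" and ?l = "max (ln (K0 / \<sigma>init)) 0"
  have k0_1: "1 \<le> ?k0" by simp
  have "log 2 (\<sigma>bar / K0) \<le> real_of_int \<lceil>log 2 (\<sigma>bar / K0)\<rceil>"
    by (rule le_of_int_ceiling)
  also have "\<dots> \<le> ?k0" by (simp only: of_int_le_iff max.cobounded2)
  finally have k0: "pos_log2 (\<sigma>bar / K0) \<le> ?k0"
    using k0_1 unfolding pos_log2_def by (intro max.boundedI) linarith+
  have l: "pos_log2 (K0 / \<sigma>init) \<le> 2 * ?l"
    using inverse_ln2[of ?l] divide_right_mono[of "ln (K0 / \<sigma>init)" ?l "ln 2"]
    by (simp add: pos_log2_def log_def)
  define A where "A = max 1 (\<sigma>bar / K0)"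
  define B where "B = K0 / \<sigma>init"
  define q where "q = (2::real) ^ 22"
  have pos: "0 < A" "0 < B" "0 < q"
    using K0_pos \<sigma>init by (simp_all add: A_def B_def q_def)
  \<comment> \<open>The exponent \<open>22\<close> is the least one with \<open>\<kappa> \<le> 2 ^ 22\<close>.\<close>
  have log_q: "log 2 q = 22"
    unfolding q_def by (subst log_pow_cancel) simp_all
  have "\<kappa> \<le> q" by (simp add: \<kappa>_def q_def)
  have "\<sigma> m \<le> \<kappa> * max \<sigma>bar K0" by (rule regularization_le)
  also have "\<dots> \<le> q * max \<sigma>bar K0"
    using K0_pos \<open>\<kappa> \<le> q\<close> by (intro mult_right_mono) auto
  also have "max \<sigma>bar K0 = A * (B * \<sigma>init)"
    using K0_pos \<sigma>init by (auto simp: max_def field_simps A_def B_def)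
  finally have "\<sigma> m / \<sigma>init \<le> q * (A * B)"
    using \<sigma>init by (simp add: pos_divide_le_eq mult.assoc)
  moreover have "\<sigma> m / 2 / \<sigma>init \<le> \<sigma> m / \<sigma>init"
    using \<sigma>_pos[of m] \<sigma>init by (intro divide_right_mono) auto
  ultimately have "log 2 (\<sigma> m / 2 / \<sigma>init) \<le> log 2 (q * (A * B))"
    using \<sigma>_pos[of m] \<sigma>init pos by (subst log_le_cancel_iff) auto
  also have "\<dots> = 22 + (log 2 A + log 2 B)"
    using pos by (simp add: log_mult log_q)
  finally have "log 2 (\<sigma> m / 2 / \<sigma>init) \<le> 22 + (?k0 + 2 * ?l)"
    using k0 l log2_le_pos_log2[of B] log2_le_pos_log2[of "\<sigma>bar / K0"]
      pos_log2_nonneg[of "\<sigma>bar / K0"] by (auto simp: A_def B_def max_def split: if_splits)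
  moreover have "real N \<le> 1 + 2 * pos_log2 (\<sigma>bar / K0) + 172 * \<kappa>\<^sup>2 * (rate * \<Delta>)"
    by (rule count_nonstationary[OF nonstationary])
  moreover have "172 * \<kappa>\<^sup>2 * (rate * \<Delta>) = 172 * (\<kappa>\<^sup>2 * (\<Delta> * rate))" by simp
  ultimately have "1 + 3 * real N + log 2 (\<sigma> m / 2 / \<sigma>init)
      \<le> 516 * (\<kappa>\<^sup>2 * (\<Delta> * rate)) + 33 * ?k0 + 2 * ?l"
    using k0 k0_1 by linarith
  also have "\<dots> \<le> 516 * (\<kappa>\<^sup>2 * (\<Delta> * rate)) + 516 * (\<kappa>\<^sup>2 * ?k0) + 516 * (\<kappa>\<^sup>2 * ?l)"
    using k0_1 by (intro add_mono) (auto simp: \<kappa>_def)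
  finally show ?thesis by (simp add: distrib_left)
qed

end

end

section \<open>Runs of the method\<close>

lemma rejected_regularization_less:
  assumes "C_diff d 3 f" "x \<in> euclid d" "0 < L0" "0 \<le> L1"
    and "\<forall>x\<in>euclid d. tensor_norm d (third f x) \<le> L0 + L1 * vnorm d (grad f x)"
    and "trial_step d f \<sigma> x s" "\<not> acceptable d f \<sigma> x s"
    and "0 \<le> M" "psd d (add_id (hess f x) M)"
  shows "\<sigma> < 12 * (L0 + L1 * vnorm d (grad f x) + sqrt L1 * M)"
  using large_regularization_accepted[of d f x L0 L1 \<sigma> s M] assms by linarith

lemma psd_add_id_mono:
  assumes "psd d (add_id A a)" "a \<le> b"
  shows "psd d (add_id A b)"
  unfolding psd_add_id
proof
  fix v assume "v \<in> euclid d"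
  then have "0 \<le> ip d (mat_vec d A v) v + a * (vnorm d v)\<^sup>2"
    using assms(1) by (simp add: psd_add_id)
  also have "\<dots> \<le> ip d (mat_vec d A v) v + b * (vnorm d v)\<^sup>2"
    using assms(2) by (simp add: mult_right_mono)
  finally show "0 \<le> ip d (mat_vec d A v) v + b * (vnorm d v)\<^sup>2" .
qed

locale cubic_newton_execution =
  fixes d :: nat and f :: "vect \<Rightarrow> real" and x0 :: vect and \<sigma>init L0 L1 :: real
    and run :: "nat \<Rightarrow> vect \<times> real \<times> nat"
  assumes smooth: "C_diff d 3 f" and x0: "x0 \<in> euclid d"
    and \<sigma>init: "0 < \<sigma>init" and L0: "0 < L0" and L1: "0 \<le> L1"
    and third_bound:
      "\<forall>x\<in>euclid d. tensor_norm d (third f x) \<le> L0 + L1 * vnorm d (grad f x)"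
    and bdd: "bdd_below (f ` euclid d)"
    and run: "cubic_newton_run d f x0 \<sigma>init run"
begin

definition point :: "nat \<Rightarrow> vect" where "point t = fst (run t)"
definition reg :: "nat \<Rightarrow> real" where "reg t = fst (snd (run t))"
definition calls :: "nat \<Rightarrow> nat" where "calls t = snd (snd (run t))"

definition accepts :: "nat \<Rightarrow> vect \<Rightarrow> bool"
  where "accepts t s \<longleftrightarrow> trial_step d f (reg t) (point t) s \<and> acceptable d f (reg t) (point t) s \<and>
    point (Suc t) = vadd (point t) s \<and> reg (Suc t) = reg t / 2 \<and> calls (Suc t) = calls t + 2"

definition rejects :: "nat \<Rightarrow> vect \<Rightarrow> bool"
  where "rejects t s \<longleftrightarrow> trial_step d f (reg t) (point t) s \<and> \<not> acceptable d f (reg t) (point t) s \<and>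
    point (Suc t) = point t \<and> reg (Suc t) = 2 * reg t \<and> calls (Suc t) = calls t + 1"

lemma run_0: "point 0 = x0" "reg 0 = \<sigma>init" "calls 0 = 1"
  using run by (simp_all add: cubic_newton_run_def point_def reg_def calls_def)

lemma run_Suc: "(\<exists>s. accepts t s) \<or> (\<exists>s. rejects t s)"
proof -
  have "cubic_newton_step d f (point t, reg t, calls t) (point (Suc t), reg (Suc t), calls (Suc t))"
    using run by (simp add: cubic_newton_run_def point_def reg_def calls_def)
  then show ?thesis
    by cases (auto simp: accepts_def rejects_def)
qed

lemma trial_in_euclid: "accepts t s \<Longrightarrow> s \<in> euclid d" "rejects t s \<Longrightarrow> s \<in> euclid d"
  by (simp_all add: accepts_def rejects_def trial_step_def)

lemma reg_pos: "0 < reg t"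
proof (induction t)
  case (Suc t)
  then show ?case using run_Suc[of t] by (auto simp: accepts_def rejects_def)
qed (simp add: run_0 \<sigma>init)

lemma point_in: "point t \<in> euclid d"
proof (induction t)
  case (Suc t)
  then show ?case using run_Suc[of t] trial_in_euclid[of t]
    by (auto simp: accepts_def rejects_def)
qed (simp add: run_0 x0)

lemma trial_psd:
  assumes "trial_step d f (reg t) x s"
  shows "0 \<le> 7 / 6 * reg t * vnorm d s" "psd d (add_id (hess f x) (7 / 6 * reg t * vnorm d s))"
  using assms reg_pos[of t] by (auto simp: trial_step_def)

lemma rejects_reg_less:
  assumes "rejects t s" "0 \<le> M" "psd d (add_id (hess f (point t)) M)"
  shows "reg t < 12 * (L0 + L1 * vnorm d (grad f (point t)) + sqrt L1 * M)"
  using assms by (intro rejected_regularization_less[OF smooth point_in L0 L1 third_bound])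
    (auto simp: rejects_def)

text \<open>During a stretch of rejected trials the point stays, the parameter doubles and each trial costs one
  call.\<close>

lemma rejections:
  assumes "\<And>t. b \<le> t \<Longrightarrow> t < b + j \<Longrightarrow> \<nexists>s. accepts t s"
  shows "point (b + j) = point b \<and> reg (b + j) = reg b * 2 ^ j \<and> calls (b + j) = calls b + j"
  using assms
proof (induction j)
  case (Suc j)
  then have "\<exists>s. rejects (b + j) s" using run_Suc[of "b + j"] by auto
  then show ?case using Suc by (auto simp: rejects_def)
qed simp

text \<open>The trial loop ends: the first trial at a point bounds the curvature there, so by
  \<open>rejects_reg_less\<close> the doubling parameters of rejected trials would stay bounded.\<close>

lemma acceptance: "\<exists>t\<ge>b. \<exists>s. accepts t s"
proof (rule ccontr)
  assume "\<not> ?thesis"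
  then have never: "\<nexists>s. accepts t s" if "b \<le> t" for t using that by auto
  then have rej: "\<exists>s. rejects t s" if "b \<le> t" for t using that run_Suc[of t] by auto
  obtain s where s: "rejects b s" using rej[of b] by auto
  define M where "M = 7 / 6 * reg b * vnorm d s"
  define T where "T = 12 * (L0 + L1 * vnorm d (grad f (point b)) + sqrt L1 * M)"
  have M: "0 \<le> M" "psd d (add_id (hess f (point b)) M)"
    using s trial_psd[of b "point b" s] by (auto simp: rejects_def M_def)
  have "reg b * 2 ^ j < T" for j
  proof -
    have *: "point (b + j) = point b" "reg (b + j) = reg b * 2 ^ j"
      using rejections[of b j] never by auto
    obtain s where "rejects (b + j) s" using rej[of "b + j"] by auto
    from rejects_reg_less[OF this M(1)] show ?thesis using M(2) by (simp add: * T_def)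
  qed
  moreover obtain j where "T / reg b < 2 ^ j"
    using real_arch_pow[of 2 "T / reg b"] by auto
  ultimately show False
    using reg_pos[of b] by (simp add: pos_divide_less_eq mult.commute) (meson less_asym)
qed

definition next_accept :: "nat \<Rightarrow> nat"
  where "next_accept b = (LEAST t. b \<le> t \<and> (\<exists>s. accepts t s))"

text \<open>\<open>start k\<close> is the time at which iterate \<open>k\<close> is reached, before any trial at it.\<close>

primrec start :: "nat \<Rightarrow> nat" where
  "start 0 = 0"
| "start (Suc k) = Suc (next_accept (start k))"

lemma next_accept: "b \<le> next_accept b" "\<exists>s. accepts (next_accept b) s"
  using LeastI_ex[of "\<lambda>t. b \<le> t \<and> (\<exists>s. accepts t s)"] acceptance[of b]
  by (auto simp: next_accept_def)

lemma before_next_accept: "b \<le> t \<Longrightarrow> t < next_accept b \<Longrightarrow> \<nexists>s. accepts t s"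
  using not_less_Least[of t "\<lambda>t. b \<le> t \<and> (\<exists>s. accepts t s)"] by (auto simp: next_accept_def)

lemma until_next_accept:
  "b + j \<le> next_accept b \<Longrightarrow>
    point (b + j) = point b \<and> reg (b + j) = reg b * 2 ^ j \<and> calls (b + j) = calls b + j"
  using before_next_accept[of b] by (intro rejections) auto

definition accept_time :: "nat \<Rightarrow> nat" where "accept_time k = next_accept (start k)"
definition step :: "nat \<Rightarrow> vect" where "step k = (SOME s. accepts (accept_time k) s)"
definition iterate :: "nat \<Rightarrow> vect" where "iterate k = point (start k)"
definition \<sigma> :: "nat \<Rightarrow> real" where "\<sigma> k = reg (accept_time k)"
definition r :: "nat \<Rightarrow> real" where "r k = vnorm d (step k)"
definition D :: "nat \<Rightarrow> real" where "D k = f (iterate k) - f (iterate (Suc k))"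
definition G :: "nat \<Rightarrow> real" where "G k = vnorm d (grad f (iterate k))"
definition \<Delta> :: real where "\<Delta> = f x0 - (INF x\<in>euclid d. f x)"

lemma accepts_step: "accepts (accept_time k) (step k)"
  unfolding step_def accept_time_def using next_accept(2) by (rule someI_ex)

lemma accept_time_split:
  obtains j where "accept_time k = start k + j" "point (accept_time k) = iterate k"
    "\<sigma> k = reg (start k) * 2 ^ j" "calls (accept_time k) = calls (start k) + j"
proof -
  obtain j where j: "next_accept (start k) = start k + j"
    using next_accept(1)[of "start k"] le_Suc_ex by blast
  show ?thesis
    using until_next_accept[of "start k" j] j
    by (intro that[of j]) (simp_all add: accept_time_def iterate_def \<sigma>_def)
qed

lemma point_accept_time: "point (accept_time k) = iterate k"
  using accept_time_split[of k] by metis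

lemma step_facts:
  "trial_step d f (\<sigma> k) (iterate k) (step k)" "acceptable d f (\<sigma> k) (iterate k) (step k)"
  "iterate (Suc k) = vadd (iterate k) (step k)"
  "reg (start (Suc k)) = \<sigma> k / 2" "calls (start (Suc k)) = calls (accept_time k) + 2"
  using accepts_step[of k] point_accept_time[of k]
  unfolding accepts_def \<sigma>_def iterate_def[of "Suc k"] accept_time_def
  by simp_all

lemma \<sigma>_pos: "0 < \<sigma> k"
  by (simp add: \<sigma>_def reg_pos)

text \<open>If the accepted trial is not the first one at its iterate, the trial before it used half its parameter
  and was rejected. The accepted step supplies the curvature bound \<open>7 / 6 * \<sigma> k * r k\<close> at this iterate, although the
  rejected trial came earlier.\<close>

lemma regularization_cases:
  "\<sigma> k = reg (start k) \<or> \<sigma> k \<le> 24 * (L0 + L1 * G k + sqrt L1 * (7 / 6 * \<sigma> k * r k))"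
proof -
  obtain j where j: "accept_time k = start k + j" "\<sigma> k = reg (start k) * 2 ^ j"
    by (rule accept_time_split)
  show ?thesis
  proof (cases j)
    case (Suc i)
    let ?t = "start k + i"
    have t: "point ?t = iterate k" "reg ?t = reg (start k) * 2 ^ i"
      using until_next_accept[of "start k" i] j Suc by (auto simp: accept_time_def iterate_def)
    have "\<nexists>s. accepts ?t s"
      using before_next_accept[of "start k" ?t] j Suc by (auto simp: accept_time_def)
    then obtain s where s: "rejects ?t s" using run_Suc[of ?t] by auto
    have "0 \<le> 7 / 6 * \<sigma> k * r k" "psd d (add_id (hess f (iterate k)) (7 / 6 * \<sigma> k * r k))"
      using trial_psd[of "accept_time k" "iterate k" "step k"] step_facts(1)[of k]
      by (auto simp: \<sigma>_def r_def)
    then have "reg ?t < 12 * (L0 + L1 * G k + sqrt L1 * (7 / 6 * \<sigma> k * r k))"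
      using rejects_reg_less[OF s, of "7 / 6 * \<sigma> k * r k"] unfolding t G_def by blast
    then show ?thesis using j(2) t(2) Suc by simp
  qed (use j in simp)
qed

lemma iterate_in: "iterate k \<in> euclid d"
  by (simp add: iterate_def point_in)

lemma sum_D: "(\<Sum>k<n. D k) = f x0 - f (iterate n)"
  by (induction n) (simp_all add: D_def iterate_def run_0)

lemma sum_D_le: "(\<Sum>k<n. D k) \<le> \<Delta>"
  using cINF_lower[OF bdd iterate_in[of n]] by (simp add: sum_D \<Delta>_def)

sublocale progress: cubic_newton_progress L0 L1 \<Delta> \<sigma>init \<sigma> r D G
proof
  fix k n
  show "0 \<le> r k" "0 \<le> G k" by (simp_all add: r_def G_def)
  show "\<sigma> k * r k ^ 3 / 6 \<le> D k"
    using step_facts(2,3)[of k] by (simp add: acceptable_def D_def r_def)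
  show "G (Suc k) \<le> 19 / 12 * \<sigma> k * (r k)\<^sup>2"
    using step_facts(2,3)[of k] by (simp add: acceptable_def G_def r_def)
  show "\<sigma> 0 \<le> \<sigma>init \<or> \<sigma> 0 \<le> 24 * (L0 + L1 * G 0 + sqrt L1 * (7 / 6 * \<sigma> 0 * r 0))"
    using regularization_cases[of 0] by (auto simp: run_0)
  show "\<sigma> (Suc k) \<le> \<sigma> k / 2 \<or>
      \<sigma> (Suc k) \<le> 24 * (L0 + L1 * G (Suc k) + sqrt L1 * (7 / 6 * \<sigma> (Suc k) * r (Suc k)))"
    using regularization_cases[of "Suc k"] step_facts(4)[of k] by auto
qed (use L0 L1 \<sigma>init \<sigma>_pos sum_D_le in auto)

text \<open>The logarithm of the parameter counts rejections minus acceptances. An acceptance costs two calls, a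
  rejection one, so three calls per acceptance plus the change of the logarithm is the exact cost.\<close>

lemma calls_start: "real (calls (start k)) = 1 + 3 * real k + log 2 (reg (start k) / \<sigma>init)"
proof (induction k)
  case 0
  then show ?case using \<sigma>init by (simp add: run_0)
next
  case (Suc k)
  obtain j where j: "\<sigma> k = reg (start k) * 2 ^ j" "calls (accept_time k) = calls (start k) + j"
    by (rule accept_time_split)
  have "reg (start (Suc k)) / \<sigma>init = (reg (start k) / \<sigma>init) * 2 ^ j / 2"
    by (simp add: step_facts(4) j(1) del: start.simps)
  then have "log 2 (reg (start (Suc k)) / \<sigma>init) = log 2 (reg (start k) / \<sigma>init) + real j - 1"
    using reg_pos[of "start k"] \<sigma>init
    by (simp add: log_mult log_divide log_nat_power del: start.simps)
  then show ?case
    using Suc by (simp add: step_facts(5) j(2) del: start.simps)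
qed

lemma nonstationary_cases:
  assumes "\<not> stationary d f \<epsilon> \<delta> (iterate k)"
  shows "\<epsilon> < G k \<or> \<delta> < 7 / 6 * \<sigma> k * r k"
proof (rule ccontr)
  assume "\<not> ?thesis"
  moreover have "psd d (add_id (hess f (iterate k)) (7 / 6 * \<sigma> k * r k))"
    using step_facts(1)[of k] by (simp add: trial_step_def r_def)
  ultimately show False
    using assms psd_add_id_mono[of d "hess f (iterate k)" "7 / 6 * \<sigma> k * r k" \<delta>]
    by (auto simp: stationary_def G_def)
qed

theorem finds_stationary:
  assumes \<epsilon>: "0 < \<epsilon>" and \<delta>: "0 < \<delta>"
  shows "finds_within d f \<epsilon> \<delta> run (516 * \<kappa>\<^sup>2 * (\<Delta> * progress.rate \<epsilon> \<delta>
    + max 1 \<lceil>log 2 (progress.\<sigma>bar / progress.K0)\<rceil> + max (ln (progress.K0 / \<sigma>init)) 0))"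
    (is "finds_within _ _ _ _ _ ?B")
proof -
  let ?S = "\<lambda>k. stationary d f \<epsilon> \<delta> (iterate k)"
  have "\<exists>k. ?S k"
  proof (rule ccontr)
    assume "\<not> ?thesis"
    then have "\<epsilon> < G k \<or> \<delta> < 7 / 6 * \<sigma> k * r k" for k using nonstationary_cases by blast
    then have "real N \<le> 1 + 2 * pos_log2 (progress.\<sigma>bar / progress.K0)
        + 172 * \<kappa>\<^sup>2 * (progress.rate \<epsilon> \<delta> * \<Delta>)" for N
      by (intro progress.count_nonstationary[OF \<epsilon> \<delta>])
    then show False by (meson not_less reals_Archimedean2)
  qed
  then obtain N where N: "?S N" and before: "\<And>k. k < N \<Longrightarrow> \<not> ?S k"
    using LeastI_ex[of ?S] not_less_Least[of _ ?S] by blast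
  have "real (calls (start N)) \<le> ?B"
  proof (cases N)
    case 0
    have "1 \<le> real_of_int (max 1 \<lceil>log 2 (progress.\<sigma>bar / progress.K0)\<rceil>)" by simp
    moreover have "0 \<le> \<Delta> * progress.rate \<epsilon> \<delta>"
      using progress.\<Delta>_nonneg progress.rate_nonneg[OF \<epsilon> \<delta>] by simp
    ultimately have "1 * 1 \<le> ?B"
      by (intro mult_mono) (auto simp: \<kappa>_def)
    then show ?thesis using 0 by (simp add: run_0)
  next
    case (Suc m)
    have "1 + 3 * real N + log 2 (\<sigma> m / 2 / \<sigma>init) \<le> ?B"
      using before nonstationary_cases
      by (intro progress.oracle_calls_le[OF \<epsilon> \<delta> _ Suc]) blast
    then show ?thesis
      using calls_start[of N] step_facts(4)[of m] Suc by (simp del: start.simps)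
  qed
  moreover have "run (start N) = (iterate N, reg (start N), calls (start N))"
    by (simp add: iterate_def point_def reg_def calls_def)
  ultimately show ?thesis
    using N unfolding finds_within_def by blast
qed

end

theorem corollary1:
  shows "\<exists>C>0. \<forall>(d::nat) (f :: vect \<Rightarrow> real) (x0 :: vect) (\<sigma>init::real)
      (L0::real) (L1::real) (\<epsilon>::real) (\<delta>::real) run.
    1 \<le> d \<longrightarrow>
    C_diff d 3 f \<longrightarrow>
    x0 \<in> euclid d \<longrightarrow>
    \<sigma>init > 0 \<longrightarrow> L0 > 0 \<longrightarrow> L1 \<ge> 0 \<longrightarrow>
    (\<forall>x\<in>euclid d. tensor_norm d (third f x) \<le> L0 + L1 * vnorm d (grad f x)) \<longrightarrow>
    bdd_below (f ` euclid d) \<longrightarrow>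
    \<epsilon> > 0 \<longrightarrow> \<delta> > 0 \<longrightarrow>
    cubic_newton_run d f x0 \<sigma>init run \<longrightarrow>
    (let \<Delta> = f x0 - (INF x\<in>euclid d. f x);
         \<sigma>bar = max \<sigma>init (4 * L1 * vnorm d (grad f x0));
         k0 = max 1 \<lceil>log 2 (\<sigma>bar / (L0 + L1 powr (3/2) * \<Delta>))\<rceil>
     in finds_within d f \<epsilon> \<delta> run
          (C * (\<Delta> * (sqrt L0 / \<epsilon> powr (3/2) + sqrt L1 / \<epsilon> + L0\<^sup>2 / \<delta> ^ 3 + L1 / \<delta>)
                + real_of_int k0
                + max (ln ((L0 + L1 powr (3/2) * \<Delta>) / \<sigma>init)) 0)))"
proof (intro exI[of _ "516 * \<kappa>\<^sup>2"] conjI allI impI)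
  fix d f x0 and \<sigma>init L0 L1 \<epsilon> \<delta> :: real and run
  assume "1 \<le> d" "C_diff d 3 f" "x0 \<in> euclid d" "\<sigma>init > 0" "L0 > 0" and L1: "L1 \<ge> 0"
    and "\<forall>x\<in>euclid d. tensor_norm d (third f x) \<le> L0 + L1 * vnorm d (grad f x)"
    and "bdd_below (f ` euclid d)" and \<epsilon>: "\<epsilon> > 0" and \<delta>: "\<delta> > 0"
    and "cubic_newton_run d f x0 \<sigma>init run"
  then interpret cubic_newton_execution d f x0 \<sigma>init L0 L1 run
    by unfold_locales
  have "L1 powr (1 + 1/2) = L1 powr 1 * L1 powr (1/2)" by (rule powr_add)
  then have "L1 powr (3/2) = progress.P"
    using L1 by (simp add: powr_half_sqrt progress.P_def)
  then show "let \<Delta> = f x0 - (INF x\<in>euclid d. f x);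
         \<sigma>bar = max \<sigma>init (4 * L1 * vnorm d (grad f x0));
         k0 = max 1 \<lceil>log 2 (\<sigma>bar / (L0 + L1 powr (3/2) * \<Delta>))\<rceil>
     in finds_within d f \<epsilon> \<delta> run
          (516 * \<kappa>\<^sup>2 * (\<Delta> * (sqrt L0 / \<epsilon> powr (3/2) + sqrt L1 / \<epsilon> + L0\<^sup>2 / \<delta> ^ 3 + L1 / \<delta>)
                + real_of_int k0
                + max (ln ((L0 + L1 powr (3/2) * \<Delta>) / \<sigma>init)) 0))"
    using finds_stationary[OF \<epsilon> \<delta>, unfolded progress.rate_def[OF \<epsilon> \<delta>] progress.\<sigma>bar_def
        progress.K0_def G_def iterate_def start.simps run_0]
    unfolding Let_def \<Delta>_def by simp
qed simp

end
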